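(* Let $E/F$ be a field extension of degree $5$. Assume that $F$ contains an algebraically closed field $k$. Then there exists an element $a \in E$ whose minimal polynomial over $F$ is of the form $f(x) = x^5 + c_2 x^3 + c_4 x + c_5$ for some $c_2, c_4, c_5 \in F$.
   Context: No assumption is made on the characteristic of $F$ or on separability of $E/F$. The minimal polynomial is required to have degree exactly $5$ (so $a \notin F$), with vanishing coefficients of $x^4$ and $x^2$. *)

theory Defs
  imports "HOL-Algebra.Algebra" "HOL-Algebra.Algebraic_Closure"
begin

end

theory Submission
  imports Defs "HOL-Computational_Algebra.Polynomial" "HOL-Decision_Procs.Algebra_Aux"
begin

text \<open>
  An element of \<open>E\<close> outside \<open>F\<close> that is a root of a monic quintic over \<open>F\<close> has this quintic as
  its minimal polynomial, so it suffices to find such a root with vanishing \<open>x\<^sup>4\<close> and \<open>x\<^sup>2\<close>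
  coefficients. Outside the characteristics 2 and 5, write the minimal polynomial of a traceless \<open>x\<close>
  as \<open>f = x\<^sup>5 + 10 a\<^sub>2 x\<^sup>3 + 10 a\<^sub>3 x\<^sup>2 + 5 a\<^sub>4 x + a\<^sub>5\<close>. Following Hermite, take a nonzero form \<open>J\<close>
  of degree at most 3 that is apolar to \<open>f\<close> (the canonizant) and put \<open>y = J(x) / g(x)\<close> with
  \<open>g = f'/5\<close>. Let \<open>f = x g + k\<close>. Then \<open>x\<close> is a common root of \<open>y g - J\<close> and \<open>y k + x J\<close>, and their
  Bezout determinant is \<open>y\<^sup>3\<close> times a polynomial in \<open>y\<close> with terms of degrees 5, 3, 1 and 0 only,
  whose leading coefficient is the discriminant of \<open>f\<close> up to a power of 5.
  In characteristics 2 and 5, translations, inversions and one explicit transformation suffice.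
\<close>

section \<open>Polynomial identities\<close>

text \<open>Laplace expansion along the first two rows: minors of the rows \<open>a\<close>,
  \<open>b\<close> times the complementary minors of the rows \<open>c\<close>,
  \<open>d\<close>.\<close>

definition det4 where
  "det4 a0 a1 a2 a3 b0 b1 b2 b3 c0 c1 c2 c3 d0 d1 d2 d3 =
      (a0 * b1 - a1 * b0) * (c2 * d3 - c3 * d2) - (a0 * b2 - a2 * b0) * (c1 * d3 - c3 * d1)
    + (a0 * b3 - a3 * b0) * (c1 * d2 - c2 * d1) + (a1 * b2 - a2 * b1) * (c0 * d3 - c3 * d0)
    - (a1 * b3 - a3 * b1) * (c0 * d2 - c2 * d0)
    + (a2 * b3 - a3 * b2) * (c0 * d1 - c1 * (d0 :: 'a::idom))"

text \<open>Determinant of the Bezout matrix of the quartics \<open>\<Sum>a\<^sub>i x\<^sup>i\<close> and \<open>\<Sum>b\<^sub>i x\<^sup>i\<close>.\<close>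

definition bezout4 where
  "bezout4 a0 a1 a2 a3 a4 b0 b1 b2 b3 (b4 :: 'a::idom) = det4
    (a1 * b0 - b1 * a0) (a2 * b0 - b2 * a0) (a3 * b0 - b3 * a0) (a4 * b0 - b4 * a0)
    (a2 * b0 - b2 * a0) (a2 * b1 - b2 * a1 + a3 * b0 - b3 * a0)
      (a3 * b1 - b3 * a1 + a4 * b0 - b4 * a0) (a4 * b1 - b4 * a1)
    (a3 * b0 - b3 * a0) (a3 * b1 - b3 * a1 + a4 * b0 - b4 * a0)
      (a3 * b2 - b3 * a2 + a4 * b1 - b4 * a1) (a4 * b2 - b4 * a2)
    (a4 * b0 - b4 * a0) (a4 * b1 - b4 * a1) (a4 * b2 - b4 * a2) (a4 * b3 - b4 * a3)"

text \<open>Column operations: the first column becomes the values at \<open>x\<close> of the cubics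
  whose coefficients are the rows.\<close>

lemma det4_column:
  "det4 (a0 + a1 * x + a2 * x^2 + a3 * x^3) a1 a2 a3 (b0 + b1 * x + b2 * x^2 + b3 * x^3) b1 b2 b3
      (c0 + c1 * x + c2 * x^2 + c3 * x^3) c1 c2 c3 (d0 + d1 * x + d2 * x^2 + d3 * x^3) d1 d2 d3
    = det4 a0 a1 a2 a3 b0 b1 b2 b3 c0 c1 c2 c3 d0 d1 d2 d3"
  unfolding det4_def by Groebner_Basis.algebra

lemma det4_linear:
  "det4 (a * s + a' * t) a1 a2 a3 (b * s + b' * t) b1 b2 b3 (c * s + c' * t) c1 c2 c3
      (d * s + d' * t) d1 d2 d3
    = det4 a a1 a2 a3 b b1 b2 b3 c c1 c2 c3 d d1 d2 d3 * s
      + det4 a' a1 a2 a3 b' b1 b2 b3 c' c1 c2 c3 d' d1 d2 d3 * t"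
  unfolding det4_def by Groebner_Basis.algebra

text \<open>Each row of the Bezout matrix, read as a cubic and evaluated at \<open>x\<close>, is a
  combination of the two quartics. With these values in the first column, linearity in that column
  makes the determinant a combination as well, so it vanishes at a common root.\<close>

lemma bezout4_combination:
  fixes x :: "'a::idom"
  shows "\<exists>u v. bezout4 a0 a1 a2 a3 a4 b0 b1 b2 b3 b4
    = u * (a0 + a1 * x + a2 * x^2 + a3 * x^3 + a4 * x^4)
      + v * (b0 + b1 * x + b2 * x^2 + b3 * x^3 + b4 * x^4)"
proof -
  have row1: "(a1 * b0 - b1 * a0) + (a2 * b0 - b2 * a0) * x
      + (a3 * b0 - b3 * a0) * x^2 + (a4 * b0 - b4 * a0) * x^3
    = - (b1 + b2 * x + b3 * x^2 + b4 * x^3) * (a0 + a1 * x + a2 * x^2 + a3 * x^3 + a4 * x^4)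
      + (a1 + a2 * x + a3 * x^2 + a4 * x^3) * (b0 + b1 * x + b2 * x^2 + b3 * x^3 + b4 * x^4)"
    by Groebner_Basis.algebra
  have row2: "(a2 * b0 - b2 * a0) + (a2 * b1 - b2 * a1 + a3 * b0 - b3 * a0) * x
      + (a3 * b1 - b3 * a1 + a4 * b0 - b4 * a0) * x^2 + (a4 * b1 - b4 * a1) * x^3
    = - (b2 + b3 * x + b4 * x^2) * (a0 + a1 * x + a2 * x^2 + a3 * x^3 + a4 * x^4)
      + (a2 + a3 * x + a4 * x^2) * (b0 + b1 * x + b2 * x^2 + b3 * x^3 + b4 * x^4)"
    by Groebner_Basis.algebra
  have row3: "(a3 * b0 - b3 * a0) + (a3 * b1 - b3 * a1 + a4 * b0 - b4 * a0) * x
      + (a3 * b2 - b3 * a2 + a4 * b1 - b4 * a1) * x^2 + (a4 * b2 - b4 * a2) * x^3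
    = - (b3 + b4 * x) * (a0 + a1 * x + a2 * x^2 + a3 * x^3 + a4 * x^4)
      + (a3 + a4 * x) * (b0 + b1 * x + b2 * x^2 + b3 * x^3 + b4 * x^4)"
    by Groebner_Basis.algebra
  have row4: "(a4 * b0 - b4 * a0) + (a4 * b1 - b4 * a1) * x
      + (a4 * b2 - b4 * a2) * x^2 + (a4 * b3 - b4 * a3) * x^3
    = - (b4) * (a0 + a1 * x + a2 * x^2 + a3 * x^3 + a4 * x^4)
      + (a4) * (b0 + b1 * x + b2 * x^2 + b3 * x^3 + b4 * x^4)"
    by Groebner_Basis.algebra
  show ?thesis
    unfolding bezout4_def
    by (subst det4_column [of _ _ x, symmetric], unfold row1 row2 row3 row4 det4_linear) blast
qed

section \<open>Discriminant and Hermite's relations\<close>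

text \<open>The discriminant of \<open>x\<^sup>5 + 10 a\<^sub>2 x\<^sup>3 + 10 a\<^sub>3 x\<^sup>2 + 5 a\<^sub>4 x + a\<^sub>5\<close>, divided by \<open>5\<^sup>5\<close>.\<close>

definition disc5 where
  "disc5 a2 a3 a4 (a5 :: 'a::idom) =
    3456 * a2^5 * a5^2 - 11520 * a2^4 * a3 * a4 * a5 + 6400 * a2^4 * a4^3
    + 5120 * a2^3 * a3^3 * a5 - 3200 * a2^3 * a3^2 * a4^2 - 1440 * a2^3 * a4 * a5^2
    + 2640 * a2^2 * a3^2 * a5^2 + 4480 * a2^2 * a3 * a4^2 * a5 - 2560 * a2^2 * a4^4
    - 10080 * a2 * a3^3 * a4 * a5 + 5760 * a2 * a3^2 * a4^3 - 120 * a2 * a3 * a5^3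
    + 160 * a2 * a4^2 * a5^2 + 3456 * a3^5 * a5 - 2160 * a3^4 * a4^2 + 360 * a3^2 * a4 * a5^2
    - 640 * a3 * a4^3 * a5 + 256 * a4^5 + a5^4"

text \<open>Up to sign, the Bezout determinant of \<open>g - w\<close> and \<open>x w + k\<close>, where \<open>f = x g + k\<close>, is the
  characteristic polynomial of \<open>g\<close> modulo \<open>f\<close>.\<close>

lemma disc5_relation:
  fixes a2 :: "'a::idom"
  assumes "w = x^4 + 6 * a2 * x^2 + 4 * a3 * x + a4"
  shows "\<exists>u. w^5 + (-80 * a2^2 + 15 * a4) * w^4
    + (1600 * a2^4 - 720 * a2^2 * a4 + 1080 * a2 * a3^2 - 20 * a3 * a5 + 80 * a4^2) * w^3
    + (4800 * a2^4 * a4 - 3200 * a2^3 * a3^2 - 320 * a2^2 * a3 * a5 - 1760 * a2^2 * a4^2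
      + 4680 * a2 * a3^2 * a4 + 10 * a2 * a5^2 - 2160 * a3^4 - 120 * a3 * a4 * a5
      + 160 * a4^3) * w^2
    - disc5 a2 a3 a4 a5
    = u * (x^5 + 10 * a2 * x^3 + 10 * a3 * x^2 + 5 * a4 * x + a5)"
proof -
  obtain u v where "bezout4 (a4 - w) (4 * a3) (6 * a2) 0 1 a5 (4 * a4 + w) (6 * a3) (4 * a2) 0
    = u * (a4 - w + 4 * a3 * x + 6 * a2 * x^2 + 0 * x^3 + 1 * x^4)
      + v * (a5 + (4 * a4 + w) * x + 6 * a3 * x^2 + 4 * a2 * x^3 + 0 * x^4)"
    using bezout4_combination by blast
  \<comment> \<open>Since \<open>w\<close> is the value of \<open>g\<close> at \<open>x\<close>, the
    first quartic vanishes and the second, \<open>x w + k\<close>, becomes \<open>f\<close>.\<close>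
  also have "\<dots> = v * (x^5 + 10 * a2 * x^3 + 10 * a3 * x^2 + 5 * a4 * x + a5)"
    unfolding assms by Groebner_Basis.algebra
  finally have combination: "bezout4 (a4 - w) (4 * a3) (6 * a2) 0 1 a5 (4 * a4 + w) (6 * a3)
      (4 * a2) 0
    = v * (x^5 + 10 * a2 * x^3 + 10 * a3 * x^2 + 5 * a4 * x + a5)" .
  \<comment> \<open>The missing term linear in \<open>w\<close> reflects Euler's formula: the trace
    of \<open>1 / f'(x)\<close> is zero.\<close>
  have determinant: "bezout4 (a4 - w) (4 * a3) (6 * a2) 0 1 a5 (4 * a4 + w) (6 * a3) (4 * a2) 0
    = - (w^5 + (-80 * a2^2 + 15 * a4) * w^4
      + (1600 * a2^4 - 720 * a2^2 * a4 + 1080 * a2 * a3^2 - 20 * a3 * a5 + 80 * a4^2) * w^3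
      + (4800 * a2^4 * a4 - 3200 * a2^3 * a3^2 - 320 * a2^2 * a3 * a5 - 1760 * a2^2 * a4^2
        + 4680 * a2 * a3^2 * a4 + 10 * a2 * a5^2 - 2160 * a3^4 - 120 * a3 * a4 * a5
        + 160 * a4^3) * w^2
      - disc5 a2 a3 a4 a5)"
    unfolding bezout4_def det4_def disc5_def by Groebner_Basis.algebra
  show ?thesis
    by (rule exI [of _ "- v"],
      unfold mult_minus_left combination [symmetric] determinant minus_minus) (rule refl)
qed

definition cubic_coeff3 where
  "cubic_coeff3 p q r (s :: 'a::idom) =
    2160 * p^6 - 3060 * p^5 * q * r + 860 * p^5 * r^3 + 5940 * p^5 * r * s + 455 * p^4 * q^3
    - 215 * p^4 * q^2 * r^2 + 675 * p^4 * q^2 * s + 165 * p^4 * q * r^4 - 6390 * p^4 * q * r^2 * s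
    - 135 * p^4 * q * s^2 - 45 * p^4 * r^6 + 1555 * p^4 * r^4 * s + 5265 * p^4 * r^2 * s^2
    + 7965 * p^4 * s^3 - 15 * p^3 * q^4 * r + 35 * p^3 * q^3 * r^3 + 1105 * p^3 * q^3 * r * s
    - 25 * p^3 * q^2 * r^5 - 975 * p^3 * q^2 * r^3 * s - 6525 * p^3 * q^2 * r * s^2
    + 5 * p^3 * q * r^7 + 615 * p^3 * q * r^5 * s + 385 * p^3 * q * r^3 * s^2
    - 585 * p^3 * q * r * s^3 - 125 * p^3 * r^7 * s + 150 * p^3 * r^5 * s^2
    + 1315 * p^3 * r^3 * s^3 + 5940 * p^3 * r * s^4 + 10 * p^2 * q^5 * s
    - 100 * p^2 * q^4 * r^2 * s + 790 * p^2 * q^4 * s^2 + 165 * p^2 * q^3 * r^4 * s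
    + 1100 * p^2 * q^3 * r^2 * s^2 + 3070 * p^2 * q^3 * s^3 - 90 * p^2 * q^2 * r^6 * s
    - 1430 * p^2 * q^2 * r^4 * s^2 - 12220 * p^2 * q^2 * r^2 * s^3 - 8910 * p^2 * q^2 * s^4
    + 15 * p^2 * q * r^8 * s + 675 * p^2 * q * r^6 * s^2 + 5875 * p^2 * q * r^4 * s^3
    + 5220 * p^2 * q * r^2 * s^4 + 10800 * p^2 * q * s^5 - 105 * p^2 * r^8 * s^2
    - 845 * p^2 * r^6 * s^3 - 1010 * p^2 * r^4 * s^4 - 2160 * p^2 * r^2 * s^5 + 2160 * p^2 * s^6
    + 40 * p * q^5 * r * s^2 - 200 * p * q^4 * r^3 * s^2 + 520 * p * q^4 * r * s^3
    + 240 * p * q^3 * r^5 * s^2 + 640 * p * q^3 * r^3 * s^3 - 200 * p * q^3 * r * s^4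
    - 105 * p * q^2 * r^7 * s^2 - 600 * p * q^2 * r^5 * s^3 - 2440 * p * q^2 * r^3 * s^4
    - 10440 * p * q^2 * r * s^5 + 15 * p * q * r^9 * s^2 + 165 * p * q * r^7 * s^3
    + 1480 * p * q * r^5 * s^4 + 5200 * p * q * r^3 * s^5 - 1440 * p * q * r * s^6
    - 15 * p * r^9 * s^3 - 220 * p * r^7 * s^4 - 680 * p * r^5 * s^5 + 320 * p * r^3 * s^6
    + 40 * q^5 * r^2 * s^3 + 480 * q^5 * s^4 - 120 * q^4 * r^4 * s^3 - 320 * q^4 * r^2 * s^4
    + 1600 * q^4 * s^5 + 110 * q^3 * r^6 * s^3 + 120 * q^3 * r^4 * s^4 - 2520 * q^3 * r^2 * s^5
    - 4000 * q^3 * s^6 - 40 * q^2 * r^8 * s^3 + 70 * q^2 * r^6 * s^4 + 2000 * q^2 * r^4 * s^5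
    + 4240 * q^2 * r^2 * s^6 + 5 * q * r^10 * s^3 - 60 * q * r^8 * s^4 - 680 * q * r^6 * s^5
    - 1440 * q * r^4 * s^6 + 10 * r^10 * s^4 + 80 * r^8 * s^5 + 160 * r^6 * s^6"

definition cubic_coeff1 where
  "cubic_coeff1 p q r (s :: 'a::idom) =
    1215 * p^5 * r + 810 * p^4 * q^2 - 1215 * p^4 * q * r^2 - 2430 * p^4 * q * s + 180 * p^4 * r^4
    + 2025 * p^4 * r^2 * s + 3645 * p^4 * s^2 + 45 * p^3 * q^3 * r - 60 * p^3 * q^2 * r^3
    + 2025 * p^3 * q^2 * r * s + 75 * p^3 * q * r^5 - 1575 * p^3 * q * r^3 * s
    - 1215 * p^3 * q * r * s^2 - 15 * p^3 * r^7 + 165 * p^3 * r^5 * s + 270 * p^3 * r^3 * s^2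
    + 1215 * p^3 * r * s^3 - 15 * p^2 * q^5 + 45 * p^2 * q^4 * r^2 + 45 * p^2 * q^4 * s
    - 30 * p^2 * q^3 * r^4 - 15 * p^2 * q^3 * r^2 * s + 1485 * p^2 * q^3 * s^2
    + 5 * p^2 * q^2 * r^6 - 240 * p^2 * q^2 * r^4 * s - 2160 * p^2 * q^2 * r^2 * s^2
    - 2835 * p^2 * q^2 * s^3 + 185 * p^2 * q * r^6 * s + 1035 * p^2 * q * r^4 * s^2
    + 2835 * p^2 * q * r^2 * s^3 + 4860 * p^2 * q * s^4 - 30 * p^2 * r^8 * s
    - 175 * p^2 * r^6 * s^2 - 765 * p^2 * r^4 * s^3 - 1620 * p^2 * r^2 * s^4
    - 75 * p * q^5 * r * s + 140 * p * q^4 * r^3 * s + 360 * p * q^4 * r * s^2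
    - 70 * p * q^3 * r^5 * s - 80 * p * q^3 * r^3 * s^2 + 2475 * p * q^3 * r * s^3
    + 10 * p * q^2 * r^7 * s - 215 * p * q^2 * r^5 * s^2 - 3300 * p * q^2 * r^3 * s^3
    - 3240 * p * q^2 * r * s^4 + 115 * p * q * r^7 * s^2 + 1305 * p * q * r^5 * s^3
    + 1800 * p * q * r^3 * s^4 - 15 * p * r^9 * s^2 - 155 * p * r^7 * s^3 - 240 * p * r^5 * s^4
    + 5 * q^6 * s^2 - 80 * q^5 * r^2 * s^2 - 150 * q^5 * s^3 + 100 * q^4 * r^4 * s^2
    + 240 * q^4 * r^2 * s^3 + 1125 * q^4 * s^4 - 40 * q^3 * r^6 * s^2 - 50 * q^3 * r^4 * s^3
    - 960 * q^3 * r^2 * s^4 + 5 * q^2 * r^8 * s^2 - 20 * q^2 * r^6 * s^3 + 330 * q^2 * r^4 * s^4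
    + 5 * q * r^8 * s^3 - 60 * q * r^6 * s^4 + 5 * r^8 * s^4"

definition cubic_coeff0 where
  "cubic_coeff0 p q r (s :: 'a::idom) =
    729 * p^5 - 135 * p^4 * r^3 - 81 * p^3 * q^3 - 27 * p^3 * q^2 * r^2 + 243 * p^3 * q^2 * s
    + 72 * p^3 * q * r^4 + 324 * p^3 * q * r^2 * s + 2187 * p^3 * q * s^2 - 9 * p^3 * r^6
    - 162 * p^3 * r^4 * s - 972 * p^3 * r^2 * s^2 - 729 * p^3 * s^3 - 45 * p^2 * q^4 * r
    + 80 * p^2 * q^3 * r^3 + 189 * p^2 * q^3 * r * s - 51 * p^2 * q^2 * r^5
    - 450 * p^2 * q^2 * r^3 * s - 1053 * p^2 * q^2 * r * s^2 + 12 * p^2 * q * r^7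
    + 210 * p^2 * q * r^5 * s + 702 * p^2 * q * r^3 * s^2 + 729 * p^2 * q * r * s^3 - p^2 * r^9
    - 24 * p^2 * r^7 * s - 90 * p^2 * r^5 * s^2 - 162 * p^2 * r^3 * s^3 - p * q^6 + p * q^5 * r^2
    + 36 * p * q^5 * s - 195 * p * q^4 * r^2 * s - 405 * p * q^4 * s^2 + 250 * p * q^3 * r^4 * s
    + 963 * p * q^3 * r^2 * s^2 + 1350 * p * q^3 * s^3 - 124 * p * q^2 * r^6 * s
    - 696 * p * q^2 * r^4 * s^2 - 1593 * p * q^2 * r^2 * s^3 + 26 * p * q * r^8 * s
    + 194 * p * q * r^6 * s^2 + 558 * p * q * r^4 * s^3 - 2 * p * r^10 * s - 19 * p * r^8 * s^2
    - 62 * p * r^6 * s^3 - 2 * q^6 * r * s + q^5 * r^3 * s + 60 * q^5 * r * s^2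
    - 190 * q^4 * r^3 * s^2 - 450 * q^4 * r * s^3 + 180 * q^3 * r^5 * s^2 + 577 * q^3 * r^3 * s^3
    - 74 * q^2 * r^7 * s^2 - 268 * q^2 * r^5 * s^3 + 14 * q * r^9 * s^2 + 54 * q * r^7 * s^3
    - r^11 * s^2 - 4 * r^9 * s^3"

text \<open>The hypotheses say that \<open>x\<^sup>3 + r x\<^sup>2 + q x + p\<close> is apolar to the quintic; the three
  coefficients above were read off from the determinant below.\<close>

lemma hermite_relation_cubic:
  fixes p q :: "'a::idom"
  assumes "a3 = p + r * s" and "a4 = r * a3 - q * s" and "a5 = p * s - q * a3 + r * a4"
  shows "\<exists>u v. y^3 * (disc5 s a3 a4 a5 * y^5 + cubic_coeff3 p q r s * y^3
      + cubic_coeff1 p q r s * y + cubic_coeff0 p q r s)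
    = u * (y * (x^4 + 6 * s * x^2 + 4 * a3 * x + a4) - (x^3 + r * x^2 + q * x + p))
      + v * (x^5 + 10 * s * x^3 + 10 * a3 * x^2 + 5 * a4 * x + a5)"
proof -
  obtain u v where "bezout4 (y * a4 - p) (y * (4 * a3) - q) (y * (6 * s) - r) (- 1) y
      (y * a5) (y * (4 * a4) + p) (y * (6 * a3) + q) (y * (4 * s) + r) 1
    = u * ((y * a4 - p) + (y * (4 * a3) - q) * x + (y * (6 * s) - r) * x^2 + (- 1) * x^3 + y * x^4)
      + v * (y * a5 + (y * (4 * a4) + p) * x + (y * (6 * a3) + q) * x^2
          + (y * (4 * s) + r) * x^3 + 1 * x^4)"
    using bezout4_combination by blast
  \<comment> \<open>With \<open>f = x g + k\<close>, the second quartic is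
    \<open>y k + x J = y f - x (y g - J)\<close>.\<close>
  also have "\<dots>
    = (u - v * x) * (y * (x^4 + 6 * s * x^2 + 4 * a3 * x + a4) - (x^3 + r * x^2 + q * x + p))
      + (v * y) * (x^5 + 10 * s * x^3 + 10 * a3 * x^2 + 5 * a4 * x + a5)"
    by Groebner_Basis.algebra
  finally have combination: "bezout4 (y * a4 - p) (y * (4 * a3) - q) (y * (6 * s) - r) (- 1) y
      (y * a5) (y * (4 * a4) + p) (y * (6 * a3) + q) (y * (4 * s) + r) 1
    = (u - v * x) * (y * (x^4 + 6 * s * x^2 + 4 * a3 * x + a4) - (x^3 + r * x^2 + q * x + p))
      + (v * y) * (x^5 + 10 * s * x^3 + 10 * a3 * x^2 + 5 * a4 * x + a5)" .
  \<comment> \<open>In the quintic factor, degree 4 is missing by Euler's formulas for the traces of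
    \<open>x^i / f'(x)\<close> with \<open>i \<le> 3\<close>; apolarity, unfolded from
    \<open>assms\<close>, removes degree 2.\<close>
  have determinant: "bezout4 (y * a4 - p) (y * (4 * a3) - q) (y * (6 * s) - r) (- 1) y
      (y * a5) (y * (4 * a4) + p) (y * (6 * a3) + q) (y * (4 * s) + r) 1
    = y^3 * (disc5 s a3 a4 a5 * y^5 + cubic_coeff3 p q r s * y^3
      + cubic_coeff1 p q r s * y + cubic_coeff0 p q r s)"
    unfolding bezout4_def det4_def disc5_def cubic_coeff3_def cubic_coeff1_def
      cubic_coeff0_def assms
    by Groebner_Basis.algebra
  show ?thesis
    by (intro exI) (rule trans [OF determinant [symmetric] combination])
qed

definition quadratic_coeff3 where
  "quadratic_coeff3 p q (s :: 'a::idom) =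
    -5120 * p^8 + 7360 * p^7 * q^2 - 4360 * p^6 * q^4 + 1200 * p^5 * q^6 - 1280 * p^5 * q * s
    - 120 * p^4 * q^8 + 940 * p^4 * q^3 * s - 140 * p^3 * q^5 * s + 400 * p^3 * s^2
    - 110 * p^2 * q^2 * s^2 + 10 * p * q^4 * s^2 + 5 * q * s^3"

definition quadratic_coeff1 where
  "quadratic_coeff1 p q (s :: 'a::idom) =
    1280 * p^6 - 1180 * p^5 * q^2 + 400 * p^4 * q^4 - 65 * p^3 * q^6 - 20 * p^3 * q * s
    + 5 * p^2 * q^8 - 10 * p^2 * q^3 * s + 5 * p * q^5 * s - 15 * p * s^2 + 5 * q^2 * s^2"

definition quadratic_coeff0 where
  "quadratic_coeff0 p q (s :: 'a::idom) =
    -256 * p^5 + 220 * p^4 * q^2 - 60 * p^3 * q^4 + 5 * p^2 * q^6 + 20 * p^2 * q * s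
    - 10 * p * q^3 * s + q^5 * s - s^2"

text \<open>The canonizant without cubic term: seen as a cubic form, \<open>x^2 + q x + p\<close> is
  apolar to the quintic exactly under these hypotheses, which leave the constant coefficient
  \<open>s\<close> free.\<close>

lemma hermite_relation_quadratic:
  fixes p q :: "'a::idom"
  assumes "a2 = - p" and "a3 = q * a2" and "a4 = q * a3 - p * a2"
  shows "\<exists>u v. y^3 * (disc5 a2 a3 a4 s * y^5 + quadratic_coeff3 p q s * y^3
      + quadratic_coeff1 p q s * y + quadratic_coeff0 p q s)
    = u * (y * (x^4 + 6 * a2 * x^2 + 4 * a3 * x + a4) - (x^2 + q * x + p))
      + v * (x^5 + 10 * a2 * x^3 + 10 * a3 * x^2 + 5 * a4 * x + s)"
proof -
  obtain u v where "bezout4 (y * a4 - p) (y * (4 * a3) - q) (y * (6 * a2) - 1) 0 y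
      (y * s) (y * (4 * a4) + p) (y * (6 * a3) + q) (y * (4 * a2) + 1) 0
    = u * ((y * a4 - p) + (y * (4 * a3) - q) * x + (y * (6 * a2) - 1) * x^2 + 0 * x^3 + y * x^4)
      + v * (y * s + (y * (4 * a4) + p) * x + (y * (6 * a3) + q) * x^2
          + (y * (4 * a2) + 1) * x^3 + 0 * x^4)"
    using bezout4_combination by blast
  also have "\<dots> = (u - v * x) * (y * (x^4 + 6 * a2 * x^2 + 4 * a3 * x + a4) - (x^2 + q * x + p))
      + (v * y) * (x^5 + 10 * a2 * x^3 + 10 * a3 * x^2 + 5 * a4 * x + s)"
    by Groebner_Basis.algebra
  finally have combination: "bezout4 (y * a4 - p) (y * (4 * a3) - q) (y * (6 * a2) - 1) 0 y
      (y * s) (y * (4 * a4) + p) (y * (6 * a3) + q) (y * (4 * a2) + 1) 0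
    = (u - v * x) * (y * (x^4 + 6 * a2 * x^2 + 4 * a3 * x + a4) - (x^2 + q * x + p))
      + (v * y) * (x^5 + 10 * a2 * x^3 + 10 * a3 * x^2 + 5 * a4 * x + s)" .
  have determinant: "bezout4 (y * a4 - p) (y * (4 * a3) - q) (y * (6 * a2) - 1) 0 y
      (y * s) (y * (4 * a4) + p) (y * (6 * a3) + q) (y * (4 * a2) + 1) 0
    = y^3 * (disc5 a2 a3 a4 s * y^5 + quadratic_coeff3 p q s * y^3
      + quadratic_coeff1 p q s * y + quadratic_coeff0 p q s)"
    unfolding bezout4_def det4_def disc5_def quadratic_coeff3_def quadratic_coeff1_def
      quadratic_coeff0_def assms
    by Groebner_Basis.algebra
  show ?thesis
    by (intro exI) (rule trans [OF determinant [symmetric] combination])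
qed

text \<open>Cramer's rule for the apolarity conditions; \<open>e\<close> is going to be the inverse of \<open>d\<close>.\<close>

lemma cubic_apolar_solution:
  fixes a2 :: "'a::idom"
  assumes "d = a2 * a4 - a3^2 - a2^3"
    and "r = (a2 * (a5 - a2 * a3) - a3 * a4) * e"
    and "q = (a3 * (a5 - a2 * a3) - a4 * (a4 - a2^2)) * e"
  shows "r * a3 - q * a2 = a4 * (d * e)"
    and "(a3 - r * a2) * a2 - q * a3 + r * a4 = a5 * (d * e) + a2 * a3 * (1 - d * e)"
  unfolding assms by Groebner_Basis.algebra+

section \<open>Translation, inversion and the substitutions for characteristics 2 and 5\<close>

lemma quintic_shift_idom:
  fixes U :: "'a::idom"
  shows "(U + T)^5 + (C1 - 5 * T) * (U + T)^4 + (C2 - 4 * C1 * T + 10 * T^2) * (U + T)^3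
    + (C3 - 3 * C2 * T + 6 * C1 * T^2 - 10 * T^3) * (U + T)^2
    + (C4 - 2 * C3 * T + 3 * C2 * T^2 - 4 * C1 * T^3 + 5 * T^4) * (U + T)
    + (C5 - C4 * T + C3 * T^2 - C2 * T^3 + C1 * T^4 - T^5)
    = U^5 + C1 * U^4 + C2 * U^3 + C3 * U^2 + C4 * U + C5"
  by Groebner_Basis.algebra

text \<open>A division-free form of inversion: for \<open>U * V = 1\<close> the left side is the
  reversed quintic at \<open>V\<close>.\<close>

lemma quintic_reverse:
  fixes U :: "'a::idom"
  shows "C5 * V^5 + C4 * (U * V) * V^4 + C3 * (U * V)^2 * V^3 + C2 * (U * V)^3 * V^2
      + C1 * (U * V)^4 * V + (U * V)^5
    = (U^5 + C1 * U^4 + C2 * U^3 + C3 * U^2 + C4 * U + C5) * V^5"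
  by Groebner_Basis.algebra

text \<open>If \<open>x\<^sup>5 + c\<^sub>3 x\<^sup>2 + c\<^sub>4 x + c\<^sub>5 = 0\<close>, then \<open>x w = - c\<^sub>3 x\<^sup>2 - c\<^sub>5\<close>, and modulo 2 the variable \<open>x\<close> is
  eliminated by squaring twice.\<close>

lemma inverse_quartic_relation:
  fixes x :: "'a::idom"
  assumes "w = x^4 + c4" "e = c5^2 - c3^2 * c4"
  shows "y^5 * (w^5 - c4 * w^4 - (c3^2 * w + e)^2) = y^5 * ((x^5 + c3 * x^2 + c4 * x + c5)
      * (x * w - c3 * x^2 - c5) * ((x * w)^2 + (c3 * x^2 + c5)^2)
    + 4 * (c3 * c5 * x^2 * (c3 * x^2 + c5)^2 - c3^2 * c5^2 * x^4))"
    "y^5 * (w^5 - c4 * w^4 - (c3^2 * w + e)^2)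
    = (y * w)^5 - c4 * (y * w)^4 * y - c3^4 * (y * w)^2 * y^3
      - 2 * c3^2 * e * (y * w) * y^4 - e^2 * y^5"
  unfolding assms by Groebner_Basis.algebra+

text \<open>For the quintic \<open>f\<close> on the right, the second factor is
  \<open>- f(- c1 - x)\<close>. The product is invariant under \<open>x\<close> to
  \<open>- c1 - x\<close>, hence a polynomial in \<open>y = x (x + c1)\<close>. It has no
  \<open>y^4\<close> because \<open>f\<close> has no \<open>x^3\<close>.\<close>

lemma square_relation:
  fixes x :: "'a::idom"
  assumes "y = x^2 + c1 * x"
  shows "y^5 + (c1 * c3 + 2 * c4) * y^3 + (c1^2 * c4 + 3 * c1 * c5 - c3^2) * y^2
      + (c1^3 * c5 - c1 * c3 * c4 - 2 * c3 * c5 + c4^2) * y + (c1 * c4 * c5 - c1^2 * c3 * c5 - c5^2)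
    = (x^5 + c1 * x^4 + c3 * x^2 + c4 * x + c5)
      * (c1^4 * x + 4 * c1^3 * x^2 - c1^2 * c3 + 6 * c1^2 * x^3 - 2 * c1 * c3 * x
        + c1 * c4 + 4 * c1 * x^4 - c3 * x^2 + c4 * x - c5 + x^5)"
  unfolding assms by Groebner_Basis.algebra

section \<open>Evaluation of integer polynomials\<close>

text \<open>Ring identities are proved in types of class \<open>idom\<close> and transferred to the carrier-based ring
  along homomorphisms from an iterated polynomial ring over the integers.\<close>

locale class_hom = cring R for R (structure) +
  fixes h :: "'c::comm_ring_1 \<Rightarrow> 'a"
  assumes closed [simp, intro]: "h a \<in> carrier R"
    and add [simp]: "h (a + b) = h a \<oplus> h b"
    and mult [simp]: "h (a * b) = h a \<otimes> h b"
    and one [simp]: "h 1 = \<one>"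
begin

lemma zero [simp]: "h 0 = \<zero>"
  using add [of 0 0] by (metis closed add_0 add.r_cancel_one')

lemma uminus [simp]: "h (- a) = \<ominus> h a"
  using add [of "- a" a] by (simp add: minus_equality)

lemma diff [simp]: "h (a - b) = h a \<ominus> h b"
  using add [of a "- b"] by (simp add: minus_eq)

lemma power [simp]: "h (a ^ n) = h a [^] n"
  by (induction n) (simp_all add: m_comm)

lemma numeral [simp]: "h (numeral n) = \<guillemotleft>numeral n\<guillemotright>"
  by (induction n) (simp_all only: numeral.simps add one of_int_add of_int_1)

lemma combination_zero: "h a = \<zero> \<Longrightarrow> h b = \<zero> \<Longrightarrow> h (u * a + v * b) = \<zero>"
  by simp

text \<open>Universal property of the polynomial ring: coefficients are sent through
  \<open>h\<close> and the indeterminate to \<open>x\<close>, by Horner's scheme.\<close>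

lemma ex_extension:
  assumes x: "x \<in> carrier R"
  shows "\<exists>g :: 'c poly \<Rightarrow> 'a. class_hom R g \<and> g [:0, 1:] = x \<and> (\<forall>a. g [:a:] = h a)"
proof -
  define g where "g p = fold_coeffs (\<lambda>a r. h a \<oplus> x \<otimes> r) p \<zero>" for p
  have g0: "g 0 = \<zero>" by (simp add: g_def)
  have gp: "g (pCons a p) = h a \<oplus> x \<otimes> g p" for a p
    \<comment> \<open>The excepted case is \<open>pCons 0 0\<close>, which is the zero polynomial
      and has no coefficient to fold.\<close>
    using x by (cases "p = 0 \<and> a = 0") (auto simp: g_def)
  have gc: "g p \<in> carrier R" for p
    by (induction p) (simp_all add: g0 gp x)
  have ga: "g (p + q) = g p \<oplus> g q" for p q
  proof (induction p q rule: poly_induct2)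
    case (pCons a p b q)
    then show ?case by (simp add: gp gc x r_distr a_ac)
  qed (simp add: g0)
  have gs: "g (smult c q) = h c \<otimes> g q" for c q
    by (induction q) (simp_all add: g0 gp gc x r_distr m_ac)
  have gm: "g (p * q) = g p \<otimes> g q" for p q
    by (induction p) (simp_all add: g0 gp ga gs gc x l_distr r_distr m_ac)
  have "class_hom R g"
    by unfold_locales (simp_all add: gc ga gm gp g0 x one_pCons)
  moreover have "g [:0, 1:] = x" "g [:a:] = h a" for a
    by (simp_all add: gp g0 x)
  ultimately show ?thesis by blast
qed

text \<open>The list of preimages is carried along, so that each further indeterminate keeps the
  elements already reached.\<close>

lemma ex_extension_list:
  assumes "x \<in> carrier R"
  shows "\<exists>(g :: 'c poly \<Rightarrow> 'a) us. class_hom R g \<and> map g us = x # map h vs"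
proof -
  obtain g :: "'c poly \<Rightarrow> 'a" where "class_hom R g" "g [:0, 1:] = x" "\<And>a. g [:a:] = h a"
    using ex_extension [OF assms] by blast
  then show ?thesis
    by (intro exI [of _ g] exI [of _ "[:0, 1:] # map (\<lambda>a. [:a:]) vs"]) simp
qed

end

text \<open>Integer polynomials in eight indeterminates, a type of class \<open>idom\<close>, so
  that every identity proved above holds in it.\<close>

type_synonym zpoly = "int poly poly poly poly poly poly poly poly"

abbreviation (in ring) quintic :: "'a \<Rightarrow> 'a \<Rightarrow> 'a \<Rightarrow> 'a \<Rightarrow> 'a \<Rightarrow> 'a \<Rightarrow> 'a" where
  "quintic c1 c2 c3 c4 c5 x \<equiv> x [^] (5::nat) \<oplus> c1 \<otimes> x [^] (4::nat) \<oplus> c2 \<otimes> x [^] (3::nat)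
    \<oplus> c3 \<otimes> x [^] (2::nat) \<oplus> c4 \<otimes> x \<oplus> c5"

context cring begin

lemma class_hom_of_integer: "class_hom R (of_integer R)"
  by unfold_locales simp_all

lemma ex_hom_Cons:
  assumes "\<exists>(g :: 'c::comm_ring_1 \<Rightarrow> 'a) us. class_hom R g \<and> map g us = zs" "z \<in> carrier R"
  shows "\<exists>(g :: 'c poly \<Rightarrow> 'a) us. class_hom R g \<and> map g us = z # zs"
proof -
  from assms(1) obtain g :: "'c \<Rightarrow> 'a" and us where g: "class_hom R g" "map g us = zs"
    by (elim exE conjE) (rule that)
  from class_hom.ex_extension_list [OF g(1) assms(2), of us] show ?thesis
    unfolding g(2) .
qed

text \<open>Applying \<open>h\<close> to an identity at the preimages gives the identity for
  arbitrary ring elements. Shorter lists of elements are padded with zero.\<close>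

lemma zpoly_hom:
  assumes "a \<in> carrier R" "b \<in> carrier R" "c \<in> carrier R" "d \<in> carrier R"
    "e \<in> carrier R" "f \<in> carrier R" "x \<in> carrier R" "y \<in> carrier R"
  obtains h :: "zpoly \<Rightarrow> 'a" and a' b' c' d' e' f' x' y'
  where "class_hom R h" "h a' = a" "h b' = b" "h c' = c" "h d' = d"
    "h e' = e" "h f' = f" "h x' = x" "h y' = y"
proof -
  have "\<exists>(g :: int \<Rightarrow> 'a) us. class_hom R g \<and> map g us = []"
    by (intro exI [of _ "of_integer R"] exI [of _ "[]"] conjI class_hom_of_integer list.map)
  note this [THEN ex_hom_Cons, OF assms(8), THEN ex_hom_Cons, OF assms(7),
    THEN ex_hom_Cons, OF assms(6), THEN ex_hom_Cons, OF assms(5), THEN ex_hom_Cons, OF assms(4),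
    THEN ex_hom_Cons, OF assms(3), THEN ex_hom_Cons, OF assms(2), THEN ex_hom_Cons, OF assms(1)]
  then obtain h :: "zpoly \<Rightarrow> 'a" and us where h: "class_hom R h"
    and us: "map h us = [a, b, c, d, e, f, x, y]"
    by (elim exE conjE) (rule that)
  have "length us = 8"
    using arg_cong [OF us, of length] by simp
  then have "h (us ! i) = [a, b, c, d, e, f, x, y] ! i" if "i < 8" for i
    using that us nth_map [of i us h] by simp
  from this [of 0] this [of 1] this [of 2] this [of 3]
    this [of 4] this [of 5] this [of 6] this [of 7]
  show thesis
    by (intro that [OF h, of "us ! 0" "us ! 1" "us ! 2" "us ! 3"
      "us ! 4" "us ! 5" "us ! 6" "us ! 7"])
      simp_all
qed

lemma quintic_shift:
  assumes c: "x \<in> carrier R" "t \<in> carrier R" "c1 \<in> carrier R" "c2 \<in> carrier R" "c3 \<in> carrier R"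
    "c4 \<in> carrier R" "c5 \<in> carrier R"
  shows "(x \<oplus> t) [^] (5::nat) \<oplus> (c1 \<ominus> \<guillemotleft>5\<guillemotright> \<otimes> t) \<otimes> (x \<oplus> t) [^] (4::nat)
    \<oplus> (c2 \<ominus> \<guillemotleft>4\<guillemotright> \<otimes> c1 \<otimes> t \<oplus> \<guillemotleft>10\<guillemotright> \<otimes> t [^] (2::nat)) \<otimes> (x \<oplus> t) [^] (3::nat)
    \<oplus> (c3 \<ominus> \<guillemotleft>3\<guillemotright> \<otimes> c2 \<otimes> t \<oplus> \<guillemotleft>6\<guillemotright> \<otimes> c1 \<otimes> t [^] (2::nat) \<ominus> \<guillemotleft>10\<guillemotright> \<otimes> t [^] (3::nat)) \<otimes> (x \<oplus> t) [^] (2::nat)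
    \<oplus> (c4 \<ominus> \<guillemotleft>2\<guillemotright> \<otimes> c3 \<otimes> t \<oplus> \<guillemotleft>3\<guillemotright> \<otimes> c2 \<otimes> t [^] (2::nat) \<ominus> \<guillemotleft>4\<guillemotright> \<otimes> c1 \<otimes> t [^] (3::nat)
      \<oplus> \<guillemotleft>5\<guillemotright> \<otimes> t [^] (4::nat)) \<otimes> (x \<oplus> t)
    \<oplus> (c5 \<ominus> c4 \<otimes> t \<oplus> c3 \<otimes> t [^] (2::nat) \<ominus> c2 \<otimes> t [^] (3::nat) \<oplus> c1 \<otimes> t [^] (4::nat)
      \<ominus> t [^] (5::nat))
    = quintic c1 c2 c3 c4 c5 x"
proof -
  obtain h :: "zpoly \<Rightarrow> 'a" and C1 C2 C3 C4 C5 T U Z where h: "class_hom R h"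
    and v: "h C1 = c1" "h C2 = c2" "h C3 = c3" "h C4 = c4" "h C5 = c5" "h T = t" "h U = x" "h Z = \<zero>"
    using c by (rule_tac zpoly_hom [of c1 c2 c3 c4 c5 t x \<zero>]) simp_all
  interpret h: class_hom R h by (rule h)
  have "h ((U + T)^5 + (C1 - 5 * T) * (U + T)^4 + (C2 - 4 * C1 * T + 10 * T^2) * (U + T)^3
    + (C3 - 3 * C2 * T + 6 * C1 * T^2 - 10 * T^3) * (U + T)^2
    + (C4 - 2 * C3 * T + 3 * C2 * T^2 - 4 * C1 * T^3 + 5 * T^4) * (U + T)
    + (C5 - C4 * T + C3 * T^2 - C2 * T^3 + C1 * T^4 - T^5))
    = h (U^5 + C1 * U^4 + C2 * U^3 + C3 * U^2 + C4 * U + C5)"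
    by (rule arg_cong [of _ _ h], rule quintic_shift_idom)
  then show ?thesis by (simp add: v)
qed

end

section \<open>Extensions of degree five\<close>

locale quintic_extension = field R for R (structure) +
  fixes F :: "'a set"
  assumes subfield: "subfield F R"
    and dimension: "dimension 5 F (carrier R)"
begin

lemma F_carrier [simp]: "a \<in> F \<Longrightarrow> a \<in> carrier R"
  using subfieldE(3)[OF subfield] by blast

lemmas F_subring = subfieldE(1)[OF subfield]

lemmas F_closed [simp] = subringE(2,3,5-7)[OF F_subring]

lemma F_minus [simp]: "a \<in> F \<Longrightarrow> b \<in> F \<Longrightarrow> a \<ominus> b \<in> F"
  by (simp add: minus_eq)

lemma F_pow [simp]: "a \<in> F \<Longrightarrow> a [^] (n::nat) \<in> F"
  by (induction n) simp_all

lemma F_of_integer [simp]: "\<guillemotleft>i\<guillemotright> \<in> F"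
proof -
  have "\<guillemotleft>n\<guillemotright>\<^sub>\<nat> \<in> F" for n
    by (induction n) simp_all
  then show ?thesis
    by (simp add: of_integer_def)
qed

lemma F_inv [simp]: "a \<in> F \<Longrightarrow> a \<noteq> \<zero> \<Longrightarrow> inv a \<in> F"
  using subfield_m_inv(1)[OF subfield] by simp

lemma algebraic: "x \<in> carrier R \<Longrightarrow> (algebraic over F) x"
  using finite_dimension_imp_algebraic[OF subfield carrier_is_subring] dimension
  by (auto simp: finite_dimension_def)

section \<open>Minimal polynomials in an extension of degree five\<close>

lemma finite_dimension_over_intermediate:
  assumes "subfield K R" "F \<subseteq> K"
  shows "finite_dimension K (carrier R)"
proof -
  obtain Us where Us: "set Us \<subseteq> carrier R" "Span F Us = carrier R"
    using exists_base[OF subfield dimension] by blast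
  have "Span F Us \<subseteq> Span K Us"
    unfolding Span_eq_combine_set[OF subfield Us(1)] Span_eq_combine_set[OF assms(1) Us(1)]
    using assms(2) by blast
  then have "Span K Us = carrier R"
    using Us Span_in_carrier[OF subfieldE(3)[OF assms(1)] Us(1)] by blast
  then show ?thesis
    using Span_finite_dimension[OF assms(1) Us(1)] by simp
qed

text \<open>By the tower formula the degree of \<open>x\<close> divides 5, and degree 1 would put
  \<open>x\<close> into \<open>F\<close>. Coefficient lists are one longer than the degree.\<close>

lemma length_Irr:
  assumes x: "x \<in> carrier R - F"
  shows "length (Irr F x) = 6"
proof -
  let ?K = "simple_extension F x" and ?d = "length (Irr F x) - 1"
  have xc: "x \<in> carrier R" and alg: "(algebraic over F) x"
    using x algebraic by auto
  note Irr = IrrE[OF subfield xc alg]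
  have K: "subfield ?K R" "F \<subseteq> ?K"
    using simple_extension_is_subfield[OF subfield xc] alg
      simple_extension_incl[OF subfieldE(3)[OF subfield] xc] by auto
  obtain m where "dimension m ?K (carrier R)"
    using finite_dimension_over_intermediate[OF K] by (auto simp: finite_dimension_def)
  then have "dimension (?d * m) F (carrier R)"
    using telescopic_base[OF subfield K(1) dimension_simple_extension[OF subfield xc alg]] by blast
  then have "?d * m = 5"
    using dimension_is_inj[OF subfield _ dimension] by blast
  then have "?d = 1 \<or> ?d = 5"
    using dvd_imp_le[of ?d 5] dvd_triv_left[of ?d m]
    by (auto simp: le_Suc_eq numeral_eq_Suc) presburger+
  moreover have "?d \<noteq> 1"
  proof
    assume "?d = 1"
    then have "length (Irr F x) = Suc (Suc 0)"
      by simp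
    then obtain u v where uv: "Irr F x = [u, v]"
      by (auto simp: length_Suc_conv)
    then have "u = \<one>" "v \<in> F"
      using Irr(1,3) by (auto simp: univ_poly_carrier[symmetric] polynomial_def)
    then have "x = \<ominus> v"
      using Irr(4) uv xc by (simp add: eq_neg_iff_add_eq_0)
    then show False
      using x \<open>v \<in> F\<close> by simp
  qed
  ultimately show ?thesis by linarith
qed

lemma eval_list6:
  "x \<in> carrier R \<Longrightarrow> {d5, d4, d3, d2, d1, d0} \<subseteq> carrier R \<Longrightarrow>
    eval [d5, d4, d3, d2, d1, d0] x = d5 \<otimes> x [^] (5::nat) \<oplus> d4 \<otimes> x [^] (4::nat)
      \<oplus> d3 \<otimes> x [^] (3::nat) \<oplus> d2 \<otimes> x [^] (2::nat) \<oplus> d1 \<otimes> x \<oplus> d0"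
  by (simp add: a_assoc numeral_eq_Suc)

text \<open>A nontrivial relation would be a nonzero polynomial of degree at most 4 divisible by the
  minimal polynomial, which has degree 5.\<close>

lemma powers_independent:
  assumes x: "x \<in> carrier R - F" and d: "{d0, d1, d2, d3, d4} \<subseteq> F"
    and eq: "d4 \<otimes> x [^] (4::nat) \<oplus> d3 \<otimes> x [^] (3::nat) \<oplus> d2 \<otimes> x [^] (2::nat) \<oplus> d1 \<otimes> x \<oplus> d0 = \<zero>"
  shows "d0 = \<zero> \<and> d1 = \<zero> \<and> d2 = \<zero> \<and> d3 = \<zero> \<and> d4 = \<zero>"
proof -
  let ?p = "[d4, d3, d2, d1, d0]"
  have xc: "x \<in> carrier R" and alg: "(algebraic over F) x"
    using x algebraic by auto
  have dc: "set ?p \<subseteq> F" using d by simp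
  have "eval ?p x = \<zero>"
    using eq xc d by (simp add: a_assoc numeral_eq_Suc)
  then have "eval (normalize ?p) x = \<zero>"
    using eval_normalize[OF _ xc, of ?p] d by simp
  moreover have np: "normalize ?p \<in> carrier (F[X])"
    using normalize_gives_polynomial[OF dc] by (simp add: univ_poly_carrier)
  ultimately have "Irr F x pdivides normalize ?p"
    using Irr_minimal[OF subfield xc alg] by blast
  then have "normalize ?p = [] \<or> length (Irr F x) - 1 \<le> length (normalize ?p) - 1"
    using pdivides_imp_degree_le[OF F_subring IrrE(1)[OF subfield xc alg] np] by blast
  moreover have "length (normalize ?p) \<le> 5"
    using normalize_length_le[of ?p] by simp
  ultimately have "normalize ?p = []"
    using length_Irr[OF x] by (auto simp del: normalize.simps)
  then show ?thesis
    by (cases "d4 = \<zero>"; cases "d3 = \<zero>"; cases "d2 = \<zero>"; cases "d1 = \<zero>"; cases "d0 = \<zero>") simp_all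
qed

text \<open>Both quintics are monic, so their difference is a relation of degree at most 4 and has
  zero coefficients.\<close>

lemma Irr_eqI:
  assumes x: "x \<in> carrier R - F" and c: "{c1, c2, c3, c4, c5} \<subseteq> F"
    and eq: "quintic c1 c2 c3 c4 c5 x = \<zero>"
  shows "Irr F x = [\<one>, c1, c2, c3, c4, c5]"
proof -
  have xc: "x \<in> carrier R" and alg: "(algebraic over F) x"
    using x algebraic by auto
  obtain d0 d1 d2 d3 d4 d5 where I: "Irr F x = [d0, d1, d2, d3, d4, d5]"
    using length_Irr[OF x] by (auto simp: length_Suc_conv numeral_eq_Suc)
  note Irr = IrrE[OF subfield xc alg, unfolded I]
  have d: "d0 = \<one>" "{d1, d2, d3, d4, d5} \<subseteq> F"
    using Irr(1,3) by (auto simp: univ_poly_carrier[symmetric] polynomial_def)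
  have eq': "quintic d1 d2 d3 d4 d5 x = \<zero>"
    using Irr(4) xc d eval_list6[OF xc, of d0 d1 d2 d3 d4 d5] by simp
  let ?u = "\<lambda>c1 c2 c3 c4 c5. c1 \<otimes> x [^] (4::nat) \<oplus> c2 \<otimes> x [^] (3::nat) \<oplus> c3 \<otimes> x [^] (2::nat)
    \<oplus> c4 \<otimes> x \<oplus> c5"
  have "x [^] (5::nat) \<oplus> ?u c1 c2 c3 c4 c5 = x [^] (5::nat) \<oplus> ?u d1 d2 d3 d4 d5"
    using eq eq' xc c d(2) by (simp add: a_assoc)
  then have "?u c1 c2 c3 c4 c5 = ?u d1 d2 d3 d4 d5"
    using xc c d(2) by simp
  moreover have "?u (c1 \<ominus> d1) (c2 \<ominus> d2) (c3 \<ominus> d3) (c4 \<ominus> d4) (c5 \<ominus> d5)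
    = ?u c1 c2 c3 c4 c5 \<ominus> ?u d1 d2 d3 d4 d5"
    using c d(2) xc by (simp add: l_distr l_minus minus_eq minus_add a_ac)
  ultimately have "?u (c1 \<ominus> d1) (c2 \<ominus> d2) (c3 \<ominus> d3) (c4 \<ominus> d4) (c5 \<ominus> d5) = \<zero>"
    using c d(2) xc by (simp add: minus_eq r_neg)
  then have "c5 \<ominus> d5 = \<zero> \<and> c4 \<ominus> d4 = \<zero> \<and> c3 \<ominus> d3 = \<zero> \<and> c2 \<ominus> d2 = \<zero> \<and> c1 \<ominus> d1 = \<zero>"
    using powers_independent[OF x, of "c5 \<ominus> d5" "c4 \<ominus> d4" "c3 \<ominus> d3" "c2 \<ominus> d2" "c1 \<ominus> d1"] c d(2)
    by simp
  then show ?thesis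
    using I c d by (simp add: eq_diff0)
qed

section \<open>Monic quintics with a root outside the base field\<close>

text \<open>The root is hidden by a quantifier, so changes of the generating element can be chained
  as statements about coefficients.\<close>

definition quintic_root :: "'a \<Rightarrow> 'a \<Rightarrow> 'a \<Rightarrow> 'a \<Rightarrow> 'a \<Rightarrow> bool" where
  "quintic_root c1 c2 c3 c4 c5 \<longleftrightarrow> {c1, c2, c3, c4, c5} \<subseteq> F \<and> (\<exists>x \<in> carrier R - F.
     quintic c1 c2 c3 c4 c5 x = \<zero>)"

lemma ex_quintic_root: "\<exists>c1 c2 c3 c4 c5. quintic_root c1 c2 c3 c4 c5"
proof -
  have "F \<noteq> carrier R"
  proof
    assume "F = carrier R"
    then have "dimension 5 F F"
      using dimension by simp
    then show False
      using dimension_is_inj[OF subfield _ dimension_one[OF subfield], of 5] by simp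
  qed
  then obtain x where x: "x \<in> carrier R - F"
    using F_carrier by blast
  have xc: "x \<in> carrier R" and alg: "(algebraic over F) x"
    using x algebraic by auto
  obtain c0 c1 c2 c3 c4 c5 where I: "Irr F x = [c0, c1, c2, c3, c4, c5]"
    using length_Irr[OF x] by (auto simp: length_Suc_conv numeral_eq_Suc)
  note Irr = IrrE[OF subfield xc alg, unfolded I]
  have "c0 = \<one>" "{c1, c2, c3, c4, c5} \<subseteq> F"
    using Irr(1,3) by (auto simp: univ_poly_carrier[symmetric] polynomial_def)
  then show ?thesis
    using Irr(4) x eval_list6[OF xc, of c0 c1 c2 c3 c4 c5] unfolding quintic_root_def
    by (intro exI [of _ c1] exI [of _ c2] exI [of _ c3] exI [of _ c4] exI [of _ c5]
        conjI bexI [of _ x])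
      (simp_all del: eval.simps)
qed

text \<open>With \<open>d5 = \<zero>\<close> the relation would have degree at most 4 and all
  coefficients would vanish; so it can be made monic.\<close>

lemma quintic_rootI:
  assumes y: "y \<in> carrier R - F" and d: "{d0, d1, d2, d3, d4, d5} \<subseteq> F"
    and nz: "\<not> {d0, d1, d2, d3, d4, d5} \<subseteq> {\<zero>}"
    and eq: "d5 \<otimes> y [^] (5::nat) \<oplus> d4 \<otimes> y [^] (4::nat) \<oplus> d3 \<otimes> y [^] (3::nat)
      \<oplus> d2 \<otimes> y [^] (2::nat) \<oplus> d1 \<otimes> y \<oplus> d0 = \<zero>"
  shows "d5 \<noteq> \<zero>"
    and "quintic_root (inv d5 \<otimes> d4) (inv d5 \<otimes> d3) (inv d5 \<otimes> d2) (inv d5 \<otimes> d1) (inv d5 \<otimes> d0)"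
proof -
  have yc: "y \<in> carrier R" using y by simp
  show d5: "d5 \<noteq> \<zero>"
  proof
    assume "d5 = \<zero>"
    then show False
      using powers_independent [OF y, of d0 d1 d2 d3 d4] eq d nz yc by simp
  qed
  have "inv d5 \<otimes> (d5 \<otimes> y [^] (5::nat) \<oplus> d4 \<otimes> y [^] (4::nat) \<oplus> d3 \<otimes> y [^] (3::nat)
      \<oplus> d2 \<otimes> y [^] (2::nat) \<oplus> d1 \<otimes> y \<oplus> d0) = \<zero>"
    using eq d d5 by simp
  then have "quintic (inv d5 \<otimes> d4) (inv d5 \<otimes> d3) (inv d5 \<otimes> d2) (inv d5 \<otimes> d1) (inv d5 \<otimes> d0) y = \<zero>"
    using d d5 yc by (simp add: r_distr m_assoc [symmetric])
  then show "quintic_root (inv d5 \<otimes> d4) (inv d5 \<otimes> d3) (inv d5 \<otimes> d2) (inv d5 \<otimes> d1) (inv d5 \<otimes> d0)"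
    unfolding quintic_root_def using y d d5 by auto
qed

lemma quintic_rootE:
  assumes "quintic_root c1 c2 c3 c4 c5"
  obtains x where "x \<in> carrier R" "x \<notin> F" "{c1, c2, c3, c4, c5} \<subseteq> F"
    "quintic c1 c2 c3 c4 c5 x = \<zero>"
  using assms unfolding quintic_root_def by auto

lemma not_F_add:
  assumes "x \<in> carrier R" "x \<notin> F" "t \<in> F"
  shows "x \<oplus> t \<notin> F"
proof
  assume "x \<oplus> t \<in> F"
  then have "x \<oplus> t \<ominus> t \<in> F"
    using assms by simp
  then show False
    using assms by (simp add: minus_eq a_assoc r_neg)
qed

lemma quintic_root_shift:
  assumes "quintic_root c1 c2 c3 c4 c5" and t: "t \<in> F"
  shows "quintic_root (c1 \<ominus> \<guillemotleft>5\<guillemotright> \<otimes> t)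
    (c2 \<ominus> \<guillemotleft>4\<guillemotright> \<otimes> c1 \<otimes> t \<oplus> \<guillemotleft>10\<guillemotright> \<otimes> t [^] (2::nat))
    (c3 \<ominus> \<guillemotleft>3\<guillemotright> \<otimes> c2 \<otimes> t \<oplus> \<guillemotleft>6\<guillemotright> \<otimes> c1 \<otimes> t [^] (2::nat) \<ominus> \<guillemotleft>10\<guillemotright> \<otimes> t [^] (3::nat))
    (c4 \<ominus> \<guillemotleft>2\<guillemotright> \<otimes> c3 \<otimes> t \<oplus> \<guillemotleft>3\<guillemotright> \<otimes> c2 \<otimes> t [^] (2::nat) \<ominus> \<guillemotleft>4\<guillemotright> \<otimes> c1 \<otimes> t [^] (3::nat)
      \<oplus> \<guillemotleft>5\<guillemotright> \<otimes> t [^] (4::nat))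
    (c5 \<ominus> c4 \<otimes> t \<oplus> c3 \<otimes> t [^] (2::nat) \<ominus> c2 \<otimes> t [^] (3::nat) \<oplus> c1 \<otimes> t [^] (4::nat)
      \<ominus> t [^] (5::nat))"
proof -
  obtain x where x: "x \<in> carrier R" "x \<notin> F" and c: "{c1, c2, c3, c4, c5} \<subseteq> F"
    and eq: "quintic c1 c2 c3 c4 c5 x = \<zero>"
    using assms(1) by (rule quintic_rootE)
  show ?thesis
    unfolding quintic_root_def using quintic_shift [of x t c1 c2 c3 c4 c5, unfolded eq]
      x c t not_F_add [OF x t]
    by (intro conjI bexI [of _ "x \<oplus> t"]) simp_all
qed

text \<open>The inverse of the root is again outside \<open>F\<close>. Its relation has leading
  coefficient \<open>c5\<close> and constant term \<open>\<one>\<close>, which forces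
  \<open>c5 \<noteq> \<zero>\<close>. Inversion exchanges the places of \<open>c1\<close> and
  \<open>c4\<close>, and of \<open>c2\<close> and \<open>c3\<close>.\<close>

lemma quintic_root_reverse:
  assumes "quintic_root c1 c2 c3 c4 c5"
  shows "c5 \<noteq> \<zero>"
    and "quintic_root (inv c5 \<otimes> c4) (inv c5 \<otimes> c3) (inv c5 \<otimes> c2) (inv c5 \<otimes> c1) (inv c5)"
proof -
  obtain x where x: "x \<in> carrier R" "x \<notin> F" and c: "{c1, c2, c3, c4, c5} \<subseteq> F"
    and eq: "quintic c1 c2 c3 c4 c5 x = \<zero>"
    using assms(1) by (rule quintic_rootE)
  define y where "y = inv x"
  have x0: "x \<noteq> \<zero>" using x by auto
  have y: "y \<in> carrier R" and xy: "x \<otimes> y = \<one>"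
    using x x0 by (simp_all add: y_def)
  have "y \<noteq> \<zero>"
    using xy x by auto
  moreover have "inv y = x"
    using x x0 by (simp add: y_def field_Units Units_inv_inv)
  ultimately have yF: "y \<notin> F"
    using x(2) F_inv [of y] by auto
  obtain h :: "zpoly \<Rightarrow> 'a" and C1 C2 C3 C4 C5 U V Z where h: "class_hom R h"
    and v: "h C1 = c1" "h C2 = c2" "h C3 = c3" "h C4 = c4" "h C5 = c5"
        "h U = x" "h V = y" "h Z = \<zero>"
    using c x y by (rule_tac zpoly_hom [of c1 c2 c3 c4 c5 x y \<zero>]) simp_all
  interpret h: class_hom R h by (rule h)
  have "h (C5*V^5 + C4*(U*V)*V^4 + C3*(U*V)^2*V^3 + C2*(U*V)^3*V^2 + C1*(U*V)^4*V + (U*V)^5)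
    = h ((U^5 + C1*U^4 + C2*U^3 + C3*U^2 + C4*U + C5) * V^5)"
    by (rule arg_cong [of _ _ h], rule quintic_reverse)
  then have eq': "c5 \<otimes> y [^] (5::nat) \<oplus> c4 \<otimes> y [^] (4::nat) \<oplus> c3 \<otimes> y [^] (3::nat)
      \<oplus> c2 \<otimes> y [^] (2::nat) \<oplus> c1 \<otimes> y \<oplus> \<one> = \<zero>"
    using c y by (simp add: v xy eq)
  show c5: "c5 \<noteq> \<zero>"
    using quintic_rootI(1) [OF _ _ _ eq'] y yF c by auto
  show "quintic_root (inv c5 \<otimes> c4) (inv c5 \<otimes> c3) (inv c5 \<otimes> c2) (inv c5 \<otimes> c1) (inv c5)"
    using quintic_rootI(2) [OF _ _ _ eq'] y yF c c5 by auto
qed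

text \<open>If the quotient \<open>y = P / G\<close> were in \<open>F\<close>, then
  \<open>y G - P\<close> would be a relation of degree at most 4 with leading coefficient
  \<open>y\<close>. Thus \<open>y\<close> and then all coefficients of \<open>P\<close> would
  vanish.\<close>

lemma ex_quotient:
  assumes x: "x \<in> carrier R - F" and F: "{g0, g1, g2, g3, p0, p1, p2, p3} \<subseteq> F"
    and nz: "\<not> {p0, p1, p2, p3} \<subseteq> {\<zero>}"
  obtains y where "y \<in> carrier R" "y \<notin> F"
    "y \<otimes> (x [^] (4::nat) \<oplus> g3 \<otimes> x [^] (3::nat) \<oplus> g2 \<otimes> x [^] (2::nat) \<oplus> g1 \<otimes> x \<oplus> g0)
      = p3 \<otimes> x [^] (3::nat) \<oplus> p2 \<otimes> x [^] (2::nat) \<oplus> p1 \<otimes> x \<oplus> p0"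
proof -
  have xc: "x \<in> carrier R" using x by simp
  define G where "G = x [^] (4::nat) \<oplus> g3 \<otimes> x [^] (3::nat) \<oplus> g2 \<otimes> x [^] (2::nat) \<oplus> g1 \<otimes> x \<oplus> g0"
  define P where "P = p3 \<otimes> x [^] (3::nat) \<oplus> p2 \<otimes> x [^] (2::nat) \<oplus> p1 \<otimes> x \<oplus> p0"
  have GP: "G \<in> carrier R" "P \<in> carrier R"
    using xc F by (simp_all add: G_def P_def)
  have "G \<noteq> \<zero>"
    using powers_independent [OF x, of g0 g1 g2 g3 \<one>] xc F by (auto simp: G_def)
  then have y: "P \<otimes> inv G \<in> carrier R" "P \<otimes> inv G \<otimes> G = P"
    using GP by (simp_all add: m_assoc)
  have "P \<otimes> inv G \<notin> F"
  proof
    assume yF: "P \<otimes> inv G \<in> F"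
    define y where "y = P \<otimes> inv G"
    have yF: "y \<in> F" and yG: "y \<otimes> G = P"
      using yF y by (simp_all add: y_def)
    have "y \<otimes> x [^] (4::nat) \<oplus> (y \<otimes> g3 \<ominus> p3) \<otimes> x [^] (3::nat) \<oplus> (y \<otimes> g2 \<ominus> p2) \<otimes> x [^] (2::nat)
      \<oplus> (y \<otimes> g1 \<ominus> p1) \<otimes> x \<oplus> (y \<otimes> g0 \<ominus> p0) = y \<otimes> G \<ominus> P"
      unfolding G_def P_def using xc F yF
      by (simp add: minus_eq l_distr r_distr l_minus r_minus minus_add a_ac m_ac)
    also have "\<dots> = \<zero>"
      using yG GP by (simp add: minus_eq r_neg)
    finally have sum: "y \<otimes> x [^] (4::nat) \<oplus> (y \<otimes> g3 \<ominus> p3) \<otimes> x [^] (3::nat)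
      \<oplus> (y \<otimes> g2 \<ominus> p2) \<otimes> x [^] (2::nat) \<oplus> (y \<otimes> g1 \<ominus> p1) \<otimes> x \<oplus> (y \<otimes> g0 \<ominus> p0) = \<zero>" .
    have coefficients: "{y \<otimes> g0 \<ominus> p0, y \<otimes> g1 \<ominus> p1, y \<otimes> g2 \<ominus> p2, y \<otimes> g3 \<ominus> p3, y} \<subseteq> F"
      using F yF by simp
    note zero = powers_independent [OF x coefficients sum]
    have vanish: "y \<otimes> g \<ominus> p = \<zero> \<Longrightarrow> g \<in> F \<Longrightarrow> p \<in> F \<Longrightarrow> p = \<zero>" for g p
      using zero by (simp add: minus_eq)
    have "p0 = \<zero>" "p1 = \<zero>" "p2 = \<zero>" "p3 = \<zero>"
      using zero F vanish [of g0 p0] vanish [of g1 p1] vanish [of g2 p2] vanish [of g3 p3] by blast+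
    then show False
      using nz by simp
  qed
  then show thesis
    using that [of "P \<otimes> inv G"] y by (simp add: G_def P_def)
qed

section \<open>Characteristics 2 and 5\<close>

text \<open>A translation, an inversion and another translation remove both the \<open>x^4\<close>
  and the \<open>x^3\<close> term; the inverse of the derivative at such a root then generates the
  required quintic.\<close>

lemma ex_reducible_root_char_2:
  assumes char: "\<guillemotleft>2\<guillemotright> = \<zero>" and root: "quintic_root \<zero> c2 c3 c4 c5"
  shows "\<exists>c2 c4 c5. quintic_root \<zero> c2 \<zero> c4 c5"
proof -
  have n: "\<guillemotleft>4\<guillemotright> = \<zero>" "\<guillemotleft>10\<guillemotright> = \<zero>" "\<guillemotleft>6\<guillemotright> = \<zero>" "\<guillemotleft>5\<guillemotright> = \<one>" "\<guillemotleft>3\<guillemotright> = \<one>"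
    using of_int_mult [of 2 2] of_int_mult [of 2 5] of_int_mult [of 2 3]
      of_int_add [of "2 * 2" 1] of_int_add [of 2 1] char by simp_all
  have special: "\<exists>c2 c4 c5. quintic_root \<zero> c2 \<zero> c4 c5"
    if root: "quintic_root \<zero> \<zero> c3 c4 c5" for c3 c4 c5
  proof -
    obtain x where x: "x \<in> carrier R" "x \<notin> F" and c: "{c3, c4, c5} \<subseteq> F"
      and eq: "x [^] (5::nat) \<oplus> c3 \<otimes> x [^] (2::nat) \<oplus> c4 \<otimes> x \<oplus> c5 = \<zero>"
      using root by (rule quintic_rootE) (auto simp: a_assoc)
    \<comment> \<open>In characteristic 2 the derivative of the quintic is \<open>x^4 + c4\<close>,
      so \<open>y\<close> is its inverse at \<open>x\<close>.\<close>
    obtain y where y: "y \<in> carrier R" "y \<notin> F" "y \<otimes> (x [^] (4::nat) \<oplus> c4) = \<one>"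
      using ex_quotient [of x c4 \<zero> \<zero> \<zero> \<one> \<zero> \<zero> \<zero>] x c by auto
    obtain h :: "zpoly \<Rightarrow> 'a" and C3 C4 C5 U V Z Z' Z'' where h: "class_hom R h"
      and v: "h C3 = c3" "h C4 = c4" "h C5 = c5" "h U = x" "h V = y" "h Z = \<zero>" "h Z' = \<zero>" "h Z'' = \<zero>"
      using c x y by (rule_tac zpoly_hom [of c3 c4 c5 x y \<zero> \<zero> \<zero>]) simp_all
    interpret h: class_hom R h by (rule h)
    define W where "W = U^4 + C4"
    define e where "e = C5^2 - C3^2 * C4"
    have eF: "h e \<in> F"
      using c by (simp add: e_def v)
    have W: "h V \<otimes> h W = \<one>"
      using y by (simp add: W_def v)
    have "h ((V * W)^5 - C4 * (V * W)^4 * V - C3^4 * (V * W)^2 * V^3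
        - 2 * C3^2 * e * (V * W) * V^4 - e^2 * V^5) = \<zero>"
      unfolding inverse_quartic_relation(2) [OF W_def e_def, symmetric]
        inverse_quartic_relation(1) [OF W_def e_def]
      using x y c eq n by (simp add: v)
    \<comment> \<open>As \<open>y w = 1\<close> and 2 vanishes, no terms in \<open>y^4\<close> and
      \<open>y^2\<close> remain. The constant term \<open>\<one>\<close> makes the relation
      nontrivial.\<close>
    then have "\<ominus> (h e [^] (2::nat)) \<otimes> y [^] (5::nat) \<oplus> \<zero> \<otimes> y [^] (4::nat)
        \<oplus> \<ominus> (c3 [^] (4::nat)) \<otimes> y [^] (3::nat)
        \<oplus> \<zero> \<otimes> y [^] (2::nat) \<oplus> \<ominus> c4 \<otimes> y \<oplus> \<one> = \<zero>"
      using c eF y W char by (simp add: v minus_eq l_minus a_ac)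
    from quintic_rootI [OF _ _ _ this] show ?thesis
      using y c eF by auto
  qed
  show ?thesis
  proof (cases "c2 = \<zero>")
    case True
    then show ?thesis using special root by blast
  next
    case c2: False
    have c: "c2 \<in> F" "c3 \<in> F" "c4 \<in> F" "c5 \<in> F"
      using root by (auto simp: quintic_root_def)
    \<comment> \<open>Since 3 is 1 and \<open>c1\<close> is zero, this translation removes the
      \<open>x^2\<close> term and keeps \<open>c2\<close>; inversion then moves the gap to
      \<open>x^3\<close>.\<close>
    define t where "t = c3 \<otimes> inv c2"
    have t: "t \<in> F" "c2 \<otimes> t = c3"
      using c c2 by (simp_all add: t_def m_lcomm [of c2])
    obtain d1 d4 d5 where d: "quintic_root d1 c2 \<zero> d4 d5"
      using quintic_root_shift [OF root t(1)] c t n by (force simp: minus_eq r_neg)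
    then have dF: "d1 \<in> F" "d4 \<in> F" "d5 \<in> F"
      by (auto simp: quintic_root_def)
    have d5: "d5 \<noteq> \<zero>" and "\<exists>e1 e3 e4 e5. quintic_root e1 \<zero> e3 e4 e5"
      using quintic_root_reverse [OF d] dF by auto
    then obtain e1 e3 e4 e5 where e: "quintic_root e1 \<zero> e3 e4 e5"
      by blast
    then have eF: "e1 \<in> F" "e3 \<in> F" "e4 \<in> F" "e5 \<in> F"
      by (auto simp: quintic_root_def)
    \<comment> \<open>As 5 is 1, translation by \<open>e1\<close> removes the \<open>x^4\<close>
      term; as 4 and 10 vanish, the \<open>x^3\<close> term stays zero.\<close>
    have "\<exists>f3 f4 f5. quintic_root \<zero> \<zero> f3 f4 f5"
      using quintic_root_shift [OF e eF(1)] eF n by (force simp: minus_eq r_neg)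
    then show ?thesis
      using special by blast
  qed
qed

text \<open>Translations cannot change the \<open>x^4\<close> coefficient here. If it is nonzero,
  the quadratic substitution of \<open>square_relation\<close> removes it; \<open>traceless\<close>
  then clears the \<open>x^2\<close> term.\<close>

lemma ex_reducible_root_char_5:
  assumes char: "\<guillemotleft>5\<guillemotright> = \<zero>" and root: "quintic_root c1 c2 c3 c4 c5"
  shows "\<exists>c2 c4 c5. quintic_root \<zero> c2 \<zero> c4 c5"
proof -
  have n: "\<guillemotleft>10\<guillemotright> = \<zero>" "\<guillemotleft>4\<guillemotright> = \<ominus> \<one>" "\<guillemotleft>2\<guillemotright> \<noteq> \<zero>" "\<guillemotleft>3\<guillemotright> \<noteq> \<zero>"
  proof -
    show "\<guillemotleft>10\<guillemotright> = \<zero>" using of_int_mult [of 5 2] char by simp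
    show 4: "\<guillemotleft>4\<guillemotright> = \<ominus> \<one>" using of_int_diff [of 5 1] char by simp
    show "\<guillemotleft>2\<guillemotright> \<noteq> \<zero>"
    proof
      assume "\<guillemotleft>2\<guillemotright> = \<zero>"
      then have "\<guillemotleft>4\<guillemotright> = \<zero>"
        using of_int_mult [of 2 2] by simp
      then show False
        using 4 by simp
    qed
    show "\<guillemotleft>3\<guillemotright> \<noteq> \<zero>"
    proof
      assume "\<guillemotleft>3\<guillemotright> = \<zero>"
      then have "\<guillemotleft>6\<guillemotright> = \<zero>"
        using of_int_mult [of 3 2] by simp
      moreover have "\<guillemotleft>6\<guillemotright> = \<one>"
        using of_int_add [of 5 1] char by simp
      ultimately show False
        by simp
    qed
  qed
  have traceless: "\<exists>c2 c4 c5. quintic_root \<zero> c2 \<zero> c4 c5"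
    if root: "quintic_root \<zero> c2 c3 c4 c5" for c2 c3 c4 c5
  proof -
    have c: "c2 \<in> F" "c3 \<in> F" "c4 \<in> F" "c5 \<in> F"
      using root by (auto simp: quintic_root_def)
    consider "c3 = \<zero>" | "c2 \<noteq> \<zero>" | "c2 = \<zero>" "c3 \<noteq> \<zero>" by blast
    then show ?thesis
    proof cases
      case 1
      then show ?thesis using root by blast
    next
      case 2
      \<comment> \<open>With \<open>c1 = \<zero>\<close> and 10 zero, translation changes the
        \<open>x^2\<close> coefficient to \<open>c3 - 3 c2 t\<close>.\<close>
      define t where "t = c3 \<otimes> inv (\<guillemotleft>3\<guillemotright> \<otimes> c2)"
      have nz: "\<guillemotleft>3\<guillemotright> \<otimes> c2 \<noteq> \<zero>"
        using 2 n c by (simp add: integral_iff)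
      have t: "t \<in> F" "\<guillemotleft>3\<guillemotright> \<otimes> c2 \<otimes> t = c3"
        using c nz by (simp_all add: t_def m_lcomm [of "\<guillemotleft>3\<guillemotright> \<otimes> c2"])
      then show ?thesis
        using quintic_root_shift [OF root t(1)] c n char by (force simp: minus_eq r_neg)
    next
      case 3
      \<comment> \<open>With \<open>c1\<close> and \<open>c2\<close> zero, this translation removes
        the linear term and keeps \<open>c3\<close>. Inversion then sends the quintic to one with
        only an \<open>x^3\<close> term besides the leading and constant ones.\<close>
      define t where "t = c4 \<otimes> inv (\<guillemotleft>2\<guillemotright> \<otimes> c3)"
      have nz: "\<guillemotleft>2\<guillemotright> \<otimes> c3 \<noteq> \<zero>"
        using 3 n c by (simp add: integral_iff)
      have t: "t \<in> F" "\<guillemotleft>2\<guillemotright> \<otimes> c3 \<otimes> t = c4"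
        using c nz by (simp_all add: t_def m_lcomm [of "\<guillemotleft>2\<guillemotright> \<otimes> c3"])
      obtain d5 where d: "quintic_root \<zero> \<zero> c3 \<zero> d5"
        using quintic_root_shift [OF root t(1)] c t n char 3 by (force simp: minus_eq r_neg)
      then have "d5 \<in> F"
        by (simp add: quintic_root_def)
      then show ?thesis
        using quintic_root_reverse [OF d] c by auto
    qed
  qed
  have c: "c1 \<in> F" "c2 \<in> F" "c3 \<in> F" "c4 \<in> F" "c5 \<in> F"
    using root by (auto simp: quintic_root_def)
  show ?thesis
  proof (cases "c1 = \<zero>")
    case True
    then show ?thesis using traceless root by blast
  next
    case c1: False
    \<comment> \<open>As 4 is -1, the \<open>x^3\<close> coefficient becomes
      \<open>c2 + c1 t\<close>, which vanishes; this prepares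
      \<open>square_relation\<close>.\<close>
    define t where "t = \<ominus> c2 \<otimes> inv c1"
    have t: "t \<in> F" "c1 \<otimes> t = \<ominus> c2"
      using c c1 by (simp_all add: t_def m_lcomm [of c1])
    have "\<exists>d3 d4 d5. quintic_root c1 \<zero> d3 d4 d5"
      using quintic_root_shift [OF root t(1)] c t n char
      by (force simp: minus_eq r_neg l_minus m_assoc)
    then obtain d3 d4 d5 where d: "quintic_root c1 \<zero> d3 d4 d5"
      by blast
    obtain x where x: "x \<in> carrier R" "x \<notin> F" and dF: "{d3, d4, d5} \<subseteq> F"
      and eq: "x [^] (5::nat) \<oplus> c1 \<otimes> x [^] (4::nat) \<oplus> d3 \<otimes> x [^] (2::nat) \<oplus> d4 \<otimes> x \<oplus> d5 = \<zero>"
      using d by (rule quintic_rootE) (use c in \<open>auto simp: a_assoc\<close>)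
    define y where "y = x [^] (2::nat) \<oplus> c1 \<otimes> x"
    have yc: "y \<in> carrier R"
      using x c by (simp add: y_def)
    \<comment> \<open>Otherwise \<open>x\<close> would satisfy a quadratic equation over
      \<open>F\<close>.\<close>
    have yF: "y \<notin> F"
    proof
      assume "y \<in> F"
      moreover have "\<zero> \<otimes> x [^] (4::nat)
          \<oplus> \<zero> \<otimes> x [^] (3::nat) \<oplus> \<one> \<otimes> x [^] (2::nat) \<oplus> c1 \<otimes> x \<oplus> \<ominus> y = \<zero>"
        using x c by (simp add: y_def r_neg)
      ultimately show False
        using powers_independent [of x "\<ominus> y" c1 \<one> \<zero> \<zero>] x c by simp
    qed
    obtain h :: "zpoly \<Rightarrow> 'a" and C1 C3 C4 C5 U Z Z' Z'' where h: "class_hom R h"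
      and v: "h C1 = c1" "h C3 = d3" "h C4 = d4" "h C5 = d5"
        "h U = x" "h Z = \<zero>" "h Z' = \<zero>" "h Z'' = \<zero>"
      using c dF x by (rule_tac zpoly_hom [of c1 d3 d4 d5 x \<zero> \<zero> \<zero>]) simp_all
    interpret h: class_hom R h by (rule h)
    define Y where "Y = U^2 + C1 * U"
    have Y: "h Y = y"
      by (simp add: Y_def y_def v)
    define e2 where "e2 = h (C1 * C3 + 2 * C4)"
    define e3 where "e3 = h (C1^2 * C4 + 3 * C1 * C5 - C3^2)"
    define e4 where "e4 = h (C1^3 * C5 - C1 * C3 * C4 - 2 * C3 * C5 + C4^2)"
    define e5 where "e5 = h (C1 * C4 * C5 - C1^2 * C3 * C5 - C5^2)"
    have "y [^] (5::nat) \<oplus> \<zero> \<otimes> y [^] (4::nat) \<oplus> e2 \<otimes> y [^] (3::nat) \<oplus> e3 \<otimes> y [^] (2::nat)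
        \<oplus> e4 \<otimes> y \<oplus> e5
      = h (Y^5 + (C1 * C3 + 2 * C4) * Y^3 + (C1^2 * C4 + 3 * C1 * C5 - C3^2) * Y^2
        + (C1^3 * C5 - C1 * C3 * C4 - 2 * C3 * C5 + C4^2) * Y
        + (C1 * C4 * C5 - C1^2 * C3 * C5 - C5^2))"
      using yc by (simp add: Y e2_def e3_def e4_def e5_def del: h.mult h.diff) (simp add: Y)
    also have "\<dots> = \<zero>"
      unfolding square_relation [OF Y_def] using x c dF eq by (simp add: v)
    finally have "quintic_root \<zero> e2 e3 e4 e5"
      unfolding quintic_root_def using yc yF c dF
      by (auto simp: e2_def e3_def e4_def e5_def v)
    then show ?thesis
      using traceless by blast
  qed
qed

section \<open>Hermite's transformation in the remaining characteristics\<close>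

text \<open>If the discriminant vanished, \<open>disc5_relation\<close> would become
  \<open>w^2\<close> times a monic cubic in \<open>w\<close>. But \<open>w\<close> is a monic
  quartic in \<open>x\<close>, hence outside \<open>F\<close>, so it is nonzero and satisfies no
  cubic over \<open>F\<close>.\<close>

lemma disc5_nonzero:
  fixes h :: "'c::idom \<Rightarrow> 'a"
  assumes h: "class_hom R h" and x: "h x \<notin> F"
    and a: "h a2 \<in> F" "h a3 \<in> F" "h a4 \<in> F" "h a5 \<in> F"
    and root: "h (x^5 + 10 * a2 * x^3 + 10 * a3 * x^2 + 5 * a4 * x + a5) = \<zero>"
  shows "h (disc5 a2 a3 a4 a5) \<noteq> \<zero>"
proof
  interpret h: class_hom R h by (rule h)
  assume disc: "h (disc5 a2 a3 a4 a5) = \<zero>"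
  define w where "w = x^4 + 6 * a2 * x^2 + 4 * a3 * x + a4"
  have "h w \<notin> F"
  proof
    assume w: "h w \<in> F"
    have "\<one> \<otimes> h x [^] (4::nat) \<oplus> \<zero> \<otimes> h x [^] (3::nat) \<oplus> h (6 * a2) \<otimes> h x [^] (2::nat)
      \<oplus> h (4 * a3) \<otimes> h x \<oplus> h (a4 - w) = h (x^4 + 6 * a2 * x^2 + 4 * a3 * x + a4 - w)"
      by (simp add: minus_eq a_assoc)
    also have "\<dots> = \<zero>"
      by (simp add: w_def minus_eq r_neg)
    finally show False
      using powers_independent [of "h x" "h (a4 - w)" "h (4 * a3)" "h (6 * a2)" \<zero> \<one>] x a w by simp
  qed
  moreover obtain e1 e2 e3 u where "w^5 + e1 * w^4 + e2 * w^3 + e3 * w^2 - disc5 a2 a3 a4 a5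
      = u * (x^5 + 10 * a2 * x^3 + 10 * a3 * x^2 + 5 * a4 * x + a5)"
    and e: "h e1 \<in> F" "h e2 \<in> F" "h e3 \<in> F"
  proof -
    obtain u where "w^5 + (-80 * a2^2 + 15 * a4) * w^4
      + (1600 * a2^4 - 720 * a2^2 * a4 + 1080 * a2 * a3^2 - 20 * a3 * a5 + 80 * a4^2) * w^3
      + (4800 * a2^4 * a4 - 3200 * a2^3 * a3^2 - 320 * a2^2 * a3 * a5 - 1760 * a2^2 * a4^2
        + 4680 * a2 * a3^2 * a4 + 10 * a2 * a5^2 - 2160 * a3^4 - 120 * a3 * a4 * a5
        + 160 * a4^3) * w^2
      - disc5 a2 a3 a4 a5
      = u * (x^5 + 10 * a2 * x^3 + 10 * a3 * x^2 + 5 * a4 * x + a5)"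
      using disc5_relation [OF w_def, where ?a5.0 = a5] by (elim exE) (rule that)
    then show thesis
      by (rule that) (simp_all add: a)
  qed
  then have "w^2 * (w^3 + e1 * w^2 + e2 * w + e3)
      = u * (x^5 + 10 * a2 * x^3 + 10 * a3 * x^2 + 5 * a4 * x + a5) + 1 * disc5 a2 a3 a4 a5"
    by Groebner_Basis.algebra
  then have "h (w^2 * (w^3 + e1 * w^2 + e2 * w + e3)) = \<zero>"
    by (simp only: h.combination_zero [OF root disc])
  ultimately have "h (w^3 + e1 * w^2 + e2 * w + e3) = \<zero>"
    by (auto simp: integral_iff simp del: h.add)
  then show False
    using powers_independent [of "h w" "h e3" "h e2" "h e1" \<one> \<zero>] \<open>h w \<notin> F\<close> e by simp
qed

text \<open>Being outside \<open>F\<close>, the element \<open>h y\<close> is nonzero;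
  \<open>y^3\<close> cancels and division by \<open>h d\<close> leaves the required quintic.\<close>

lemma ex_reducible_root_of_relation:
  fixes h :: "'c::idom \<Rightarrow> 'a"
  assumes h: "class_hom R h" and y: "h y \<notin> F"
    and c: "h d \<in> F" "h t \<in> F" "h m \<in> F" "h n \<in> F" and d: "h d \<noteq> \<zero>"
    and rel: "h (y^3 * (d * y^5 + t * y^3 + m * y + n)) = \<zero>"
  shows "\<exists>c2 c4 c5. quintic_root \<zero> c2 \<zero> c4 c5"
proof -
  interpret h: class_hom R h by (rule h)
  have "h y \<noteq> \<zero>" using y by auto
  then have "h d \<otimes> h y [^] (5::nat) \<oplus> \<zero> \<otimes> h y [^] (4::nat) \<oplus> h t \<otimes> h y [^] (3::nat)
      \<oplus> \<zero> \<otimes> h y [^] (2::nat) \<oplus> h m \<otimes> h y \<oplus> h n = \<zero>"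
    using rel by (auto simp: integral_iff)
  from quintic_rootI [OF _ _ _ this] show ?thesis
    using y c d by auto
qed

text \<open>The new element is the quotient of the canonizant by \<open>g\<close> at
  \<open>x\<close>. Both generators in \<open>hermite_relation_cubic\<close> vanish there, and the
  leading coefficient is the nonzero discriminant.\<close>

lemma hermite_transformation_cubic:
  assumes x: "x \<in> carrier R" "x \<notin> F" and c: "{p, q, r, s} \<subseteq> F"
    and a: "a3 = p \<oplus> r \<otimes> s" "a4 = r \<otimes> a3 \<ominus> q \<otimes> s" "a5 = p \<otimes> s \<ominus> q \<otimes> a3 \<oplus> r \<otimes> a4"
    and root: "x [^] (5::nat) \<oplus> \<guillemotleft>10\<guillemotright> \<otimes> s \<otimes> x [^] (3::nat) \<oplus> \<guillemotleft>10\<guillemotright> \<otimes> a3 \<otimes> x [^] (2::nat)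
      \<oplus> \<guillemotleft>5\<guillemotright> \<otimes> a4 \<otimes> x \<oplus> a5 = \<zero>"
  shows "\<exists>c2 c4 c5. quintic_root \<zero> c2 \<zero> c4 c5"
proof -
  have aF: "a3 \<in> F" "a4 \<in> F" "a5 \<in> F"
    using c a by auto
  obtain y where y: "y \<in> carrier R" "y \<notin> F"
    "y \<otimes> (x [^] (4::nat) \<oplus> \<guillemotleft>6\<guillemotright> \<otimes> s \<otimes> x [^] (2::nat) \<oplus> \<guillemotleft>4\<guillemotright> \<otimes> a3 \<otimes> x \<oplus> a4)
      = x [^] (3::nat) \<oplus> r \<otimes> x [^] (2::nat) \<oplus> q \<otimes> x \<oplus> p"
    using ex_quotient [of x a4 "\<guillemotleft>4\<guillemotright> \<otimes> a3" "\<guillemotleft>6\<guillemotright> \<otimes> s" \<zero> p q r \<one>] x c aF by auto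
  obtain h :: "zpoly \<Rightarrow> 'a" and P Q R' S U Y Z Z' where h: "class_hom R h"
    and v: "h P = p" "h Q = q" "h R' = r" "h S = s"
        "h U = x" "h Y = y" "h Z = \<zero>" "h Z' = \<zero>"
    using c x y by (rule_tac zpoly_hom [of p q r s x y \<zero> \<zero>]) simp_all
  interpret h: class_hom R h by (rule h)
  define A3 where "A3 = P + R' * S"
  define A4 where "A4 = R' * A3 - Q * S"
  define A5 where "A5 = P * S - Q * A3 + R' * A4"
  have hA: "h A3 = a3" "h A4 = a4" "h A5 = a5"
    by (simp_all add: A3_def A4_def A5_def v a)
  have f: "h (U^5 + 10 * S * U^3 + 10 * A3 * U^2 + 5 * A4 * U + A5) = \<zero>"
    using root by (simp add: v hA)
  have g: "h (Y * (U^4 + 6 * S * U^2 + 4 * A3 * U + A4) - (U^3 + R' * U^2 + Q * U + P)) = \<zero>"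
    using y x c by (simp add: v hA minus_eq r_neg)
  obtain u v' where rel: "Y^3 * (disc5 S A3 A4 A5 * Y^5 + cubic_coeff3 P Q R' S * Y^3
      + cubic_coeff1 P Q R' S * Y + cubic_coeff0 P Q R' S)
    = u * (Y * (U^4 + 6 * S * U^2 + 4 * A3 * U + A4) - (U^3 + R' * U^2 + Q * U + P))
    + v' * (U^5 + 10 * S * U^3 + 10 * A3 * U^2 + 5 * A4 * U + A5)"
    using hermite_relation_cubic [OF A3_def A4_def A5_def, where x = U and y = Y]
    by (elim exE) (rule that)
  have "h (Y^3 * (disc5 S A3 A4 A5 * Y^5 + cubic_coeff3 P Q R' S * Y^3
      + cubic_coeff1 P Q R' S * Y + cubic_coeff0 P Q R' S)) = \<zero>"
    unfolding rel by (rule h.combination_zero [OF g f])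
  moreover have "h (disc5 S A3 A4 A5) \<noteq> \<zero>"
    using x c aF by (intro disc5_nonzero [OF h _ _ _ _ _ f]) (simp_all add: v hA)
  moreover have "h (disc5 S A3 A4 A5) \<in> F" "h (cubic_coeff3 P Q R' S) \<in> F"
    "h (cubic_coeff1 P Q R' S) \<in> F" "h (cubic_coeff0 P Q R' S) \<in> F"
    unfolding disc5_def cubic_coeff3_def cubic_coeff1_def cubic_coeff0_def
      h.add h.diff h.mult h.power h.uminus h.numeral v hA
    by (intro F_minus F_closed F_pow F_of_integer; use c aF in simp)+
  ultimately show ?thesis
    using y by (intro ex_reducible_root_of_relation [OF h, of Y]) (simp_all add: v del: h.mult)
qed

lemma hermite_transformation_quadratic:
  assumes x: "x \<in> carrier R" "x \<notin> F" and c: "{p, q, s} \<subseteq> F"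
    and a: "a2 = \<ominus> p" "a3 = q \<otimes> a2" "a4 = q \<otimes> a3 \<ominus> p \<otimes> a2"
    and root: "x [^] (5::nat) \<oplus> \<guillemotleft>10\<guillemotright> \<otimes> a2 \<otimes> x [^] (3::nat) \<oplus> \<guillemotleft>10\<guillemotright> \<otimes> a3 \<otimes> x [^] (2::nat)
      \<oplus> \<guillemotleft>5\<guillemotright> \<otimes> a4 \<otimes> x \<oplus> s = \<zero>"
  shows "\<exists>c2 c4 c5. quintic_root \<zero> c2 \<zero> c4 c5"
proof -
  have aF: "a2 \<in> F" "a3 \<in> F" "a4 \<in> F"
    using c a by auto
  obtain y where y: "y \<in> carrier R" "y \<notin> F"
    "y \<otimes> (x [^] (4::nat) \<oplus> \<guillemotleft>6\<guillemotright> \<otimes> a2 \<otimes> x [^] (2::nat) \<oplus> \<guillemotleft>4\<guillemotright> \<otimes> a3 \<otimes> x \<oplus> a4)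
      = x [^] (2::nat) \<oplus> q \<otimes> x \<oplus> p"
    using ex_quotient [of x a4 "\<guillemotleft>4\<guillemotright> \<otimes> a3" "\<guillemotleft>6\<guillemotright> \<otimes> a2" \<zero> p q \<one> \<zero>] x c aF by auto
  obtain h :: "zpoly \<Rightarrow> 'a" and P Q S U Y Z Z' Z'' where h: "class_hom R h"
    and v: "h P = p" "h Q = q" "h S = s" "h U = x" "h Y = y" "h Z = \<zero>" "h Z' = \<zero>" "h Z'' = \<zero>"
    using c x y by (rule_tac zpoly_hom [of p q s x y \<zero> \<zero> \<zero>]) simp_all
  interpret h: class_hom R h by (rule h)
  define A2 where "A2 = - P"
  define A3 where "A3 = Q * A2"
  define A4 where "A4 = Q * A3 - P * A2"
  have hA: "h A2 = a2" "h A3 = a3" "h A4 = a4"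
    using c by (simp_all add: A2_def A3_def A4_def v a l_minus r_minus minus_eq a_ac)
  have f: "h (U^5 + 10 * A2 * U^3 + 10 * A3 * U^2 + 5 * A4 * U + S) = \<zero>"
    using root by (simp add: v hA)
  have g: "h (Y * (U^4 + 6 * A2 * U^2 + 4 * A3 * U + A4) - (U^2 + Q * U + P)) = \<zero>"
    using y x c by (simp add: v hA minus_eq r_neg)
  obtain u v' where rel: "Y^3 * (disc5 A2 A3 A4 S * Y^5 + quadratic_coeff3 P Q S * Y^3
      + quadratic_coeff1 P Q S * Y + quadratic_coeff0 P Q S)
    = u * (Y * (U^4 + 6 * A2 * U^2 + 4 * A3 * U + A4) - (U^2 + Q * U + P))
    + v' * (U^5 + 10 * A2 * U^3 + 10 * A3 * U^2 + 5 * A4 * U + S)"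
    using hermite_relation_quadratic [OF A2_def A3_def A4_def, where x = U and y = Y and s = S]
    by (elim exE) (rule that)
  have "h (Y^3 * (disc5 A2 A3 A4 S * Y^5 + quadratic_coeff3 P Q S * Y^3
      + quadratic_coeff1 P Q S * Y + quadratic_coeff0 P Q S)) = \<zero>"
    unfolding rel by (rule h.combination_zero [OF g f])
  moreover have "h (disc5 A2 A3 A4 S) \<noteq> \<zero>"
    using x c aF by (intro disc5_nonzero [OF h _ _ _ _ _ f]) (simp_all add: v hA)
  moreover have "h (disc5 A2 A3 A4 S) \<in> F" "h (quadratic_coeff3 P Q S) \<in> F"
    "h (quadratic_coeff1 P Q S) \<in> F" "h (quadratic_coeff0 P Q S) \<in> F"
    unfolding disc5_def quadratic_coeff3_def quadratic_coeff1_def quadratic_coeff0_def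
      h.add h.diff h.mult h.power h.uminus h.numeral v hA
    by (intro F_minus F_closed F_pow F_of_integer; use c aF in simp)+
  ultimately show ?thesis
    using y by (intro ex_reducible_root_of_relation [OF h, of Y]) (simp_all add: v del: h.mult)
qed

text \<open>Unless \<open>c3\<close> is already zero, a canonizant is found by linear algebra: a
  cubic if its leading coefficient \<open>d\<close> is nonzero, a quadratic otherwise.\<close>

lemma ex_reducible_root_other_char:
  assumes char: "\<guillemotleft>2\<guillemotright> \<noteq> \<zero>" "\<guillemotleft>5\<guillemotright> \<noteq> \<zero>" and root: "quintic_root \<zero> c2 c3 c4 c5"
  shows "\<exists>c2 c4 c5. quintic_root \<zero> c2 \<zero> c4 c5"
proof (cases "c3 = \<zero>")
  case True
  then show ?thesis using root by blast
next
  case c3: False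
  obtain x where x: "x \<in> carrier R" "x \<notin> F" and c: "{c2, c3, c4, c5} \<subseteq> F"
    and eq: "x [^] (5::nat) \<oplus> c2 \<otimes> x [^] (3::nat) \<oplus> c3 \<otimes> x [^] (2::nat) \<oplus> c4 \<otimes> x \<oplus> c5 = \<zero>"
    using root by (rule quintic_rootE) auto
  have ten: "\<guillemotleft>10\<guillemotright> \<noteq> \<zero>"
    using of_int_mult [of 2 5] char by (simp add: integral_iff)
  \<comment> \<open>Division by the binomial coefficients 10 and 5 gives the normalised coefficients
    in which apolarity is a linear recurrence.\<close>
  define a2 where "a2 = inv \<guillemotleft>10\<guillemotright> \<otimes> c2"
  define a3 where "a3 = inv \<guillemotleft>10\<guillemotright> \<otimes> c3"
  define a4 where "a4 = inv \<guillemotleft>5\<guillemotright> \<otimes> c4"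
  have a: "a2 \<in> F" "a3 \<in> F" "a4 \<in> F" "c5 \<in> F"
    "\<guillemotleft>10\<guillemotright> \<otimes> a2 = c2" "\<guillemotleft>10\<guillemotright> \<otimes> a3 = c3" "\<guillemotleft>5\<guillemotright> \<otimes> a4 = c4"
    using c ten char by (simp_all add: a2_def a3_def a4_def m_assoc [symmetric])
  have a3: "a3 \<noteq> \<zero>"
    using a c3 by auto
  \<comment> \<open>The Hankel determinant with rows \<open>(1, 0, a2)\<close>,
    \<open>(0, a2, a3)\<close>, \<open>(a2, a3, a4)\<close>; it is the leading coefficient of the
    canonizant.\<close>
  define d where "d = a2 \<otimes> a4 \<ominus> a3 [^] (2::nat) \<ominus> a2 [^] (3::nat)"
  have d: "d \<in> F"
    using a by (simp add: d_def)
  show ?thesis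
  proof (cases "d = \<zero>")
    case False
    define e where "e = inv d"
    have e: "e \<in> F" "d \<otimes> e = \<one>"
      using d False by (simp_all add: e_def)
    obtain h :: "zpoly \<Rightarrow> 'a" and A2 A3 A4 A5 E Z Z' Z'' where h: "class_hom R h"
      and v: "h A2 = a2" "h A3 = a3" "h A4 = a4" "h A5 = c5" "h E = e" "h Z = \<zero>" "h Z' = \<zero>" "h Z'' = \<zero>"
      using a e by (rule_tac zpoly_hom [of a2 a3 a4 c5 e \<zero> \<zero> \<zero>]) simp_all
    interpret h: class_hom R h by (rule h)
    define D where "D = A2 * A4 - A3^2 - A2^3"
    define R' where "R' = (A2 * (A5 - A2 * A3) - A3 * A4) * E"
    define Q where "Q = (A3 * (A5 - A2 * A3) - A4 * (A4 - A2^2)) * E"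
    have D: "h D = d"
      by (simp add: D_def d_def v)
    have RQ: "h R' \<in> F" "h Q \<in> F"
      using a e by (simp_all add: R'_def Q_def v)
    note solution = cubic_apolar_solution [OF D_def R'_def Q_def, THEN arg_cong [of _ _ h]]
    \<comment> \<open>The first apolarity equation forces the constant coefficient
      \<open>p = a3 - r a2\<close>; Cramer's rule supplies the other two.\<close>
    have s1: "a3 = h (A3 - R' * A2) \<oplus> h R' \<otimes> a2"
      using a RQ by (simp add: v minus_eq a_assoc l_neg)
    have s2: "a4 = h R' \<otimes> a3 \<ominus> h Q \<otimes> a2"
      using solution(1) a e by (simp add: v D)
    have s3: "c5 = h (A3 - R' * A2) \<otimes> a2 \<ominus> h Q \<otimes> a3 \<oplus> h R' \<otimes> a4"
      using solution(2) a e by (simp add: v D minus_eq r_neg)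
    show ?thesis
      using hermite_transformation_cubic [OF x _ s1 s2 s3] eq a RQ by (simp add: v)
  next
    case True
    \<comment> \<open>With \<open>a2 = \<zero>\<close>, the vanishing of \<open>d\<close> would give
      \<open>a3 = \<zero>\<close>, against \<open>c3 \<noteq> \<zero>\<close>.\<close>
    have a2: "a2 \<noteq> \<zero>"
    proof
      assume "a2 = \<zero>"
      then have "d = \<ominus> (a3 \<otimes> a3)"
        unfolding d_def using a(1-3) by (simp add: numeral_eq_Suc minus_eq)
      then have "d \<oplus> a3 \<otimes> a3 = \<zero>"
        using a(2) by (simp add: l_neg)
      then have "a3 \<otimes> a3 = \<zero>"
        using True a(2) by simp
      then show False
        using a(2) a3 by (simp add: integral_iff)
    qed
    \<comment> \<open>The first two conditions on a quadratic canonizant give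
      \<open>p = - a2\<close> and this \<open>q\<close>; the third is then
      \<open>d = \<zero>\<close> divided by \<open>a2\<close>.\<close>
    define q where "q = a3 \<otimes> inv a2"
    have q: "q \<in> F" "a3 = q \<otimes> a2"
      using a a2 by (simp_all add: q_def m_assoc)
    have "a2 \<otimes> (a4 \<ominus> (q \<otimes> a3 \<oplus> a2 \<otimes> a2)) = d"
    proof -
      have "a2 \<otimes> (q \<otimes> a3) = a3 [^] (2::nat)"
        using q a by (simp add: numeral_eq_Suc m_ac)
      then show ?thesis
        using a q(1)
        by (simp add: d_def r_distr minus_eq minus_add r_minus a_ac numeral_eq_Suc m_assoc)
    qed
    then have "a4 = q \<otimes> a3 \<oplus> a2 \<otimes> a2"
      using True a2 a q(1) by (simp add: integral_iff eq_diff0)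
    then have "a4 = q \<otimes> a3 \<ominus> (\<ominus> a2) \<otimes> a2"
      using a q(1) by (simp add: minus_eq l_minus)
    then show ?thesis
      using hermite_transformation_quadratic [OF x _ _ q(2), of "\<ominus> a2" c5] eq a q(1) by simp
  qed
qed

section \<open>Combination of the characteristics\<close>

lemma ex_reducible_root: "\<exists>c2 c4 c5. quintic_root \<zero> c2 \<zero> c4 c5"
proof -
  obtain c1 c2 c3 c4 c5 where root: "quintic_root c1 c2 c3 c4 c5"
    using ex_quintic_root by blast
  then have c: "c1 \<in> F"
    by (simp add: quintic_root_def)
  show ?thesis
  proof (cases "\<guillemotleft>5\<guillemotright> = \<zero>")
    case True
    then show ?thesis using ex_reducible_root_char_5 root by blast
  next
    case False
    \<comment> \<open>Outside characteristic 5, translation by a fifth of \<open>c1\<close> makes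
      the root traceless, as the other two cases require.\<close>
    define t where "t = c1 \<otimes> inv \<guillemotleft>5\<guillemotright>"
    have t: "t \<in> F" "\<guillemotleft>5\<guillemotright> \<otimes> t = c1"
      using c False by (simp_all add: t_def m_lcomm [of "\<guillemotleft>5\<guillemotright>"])
    have "\<exists>c2 c3 c4 c5. quintic_root \<zero> c2 c3 c4 c5"
      using quintic_root_shift [OF root t(1)] c t(2) by (force simp: minus_eq r_neg)
    then show ?thesis
      using ex_reducible_root_char_2 ex_reducible_root_other_char [OF _ False] by blast
  qed
qed

lemma ex_reducible_Irr:
  "\<exists>a \<in> carrier R. \<exists>c2 \<in> F. \<exists>c4 \<in> F. \<exists>c5 \<in> F. Irr F a = [\<one>, \<zero>, c2, \<zero>, c4, c5]"
proof -
  obtain c2 c4 c5 where "quintic_root \<zero> c2 \<zero> c4 c5"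
    using ex_reducible_root by blast
  then obtain x where x: "x \<in> carrier R" "x \<notin> F" and c: "{\<zero>, c2, \<zero>, c4, c5} \<subseteq> F"
    and eq: "quintic \<zero> c2 \<zero> c4 c5 x = \<zero>"
    by (rule quintic_rootE)
  have "Irr F x = [\<one>, \<zero>, c2, \<zero>, c4, c5]"
    using Irr_eqI [OF _ c eq] x by simp
  then show ?thesis
    using x c by auto
qed

end

theorem theorem1:
  fixes E :: "('a, 'b) ring_scheme" and F k :: "'a set"
  assumes "field E"
    and "subfield F E"
    and "ring.dimension E 5 F (carrier E)"
    and "subfield k E" and "k \<subseteq> F"
    and "algebraically_closed (E \<lparr> carrier := k \<rparr>)"
  shows "\<exists>a \<in> carrier E. \<exists>c2 \<in> F. \<exists>c4 \<in> F. \<exists>c5 \<in> F.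
           ring.Irr E F a = [\<one>\<^bsub>E\<^esub>, \<zero>\<^bsub>E\<^esub>, c2, \<zero>\<^bsub>E\<^esub>, c4, c5]"
proof -
  interpret quintic_extension E F
    using assms(1-3) by (simp add: quintic_extension_def quintic_extension_axioms_def)
  show ?thesis
    by (rule ex_reducible_Irr)
qed

end
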